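(* Let $m\in\mathbb{N}$ and $d\ge 2$. There is a constant $c>0$ depending only on $m$ and $d$ such that for every $\eta\in\mathbb{S}^{d-1}$ and every $0<\varepsilon\le 1$ the following holds. Consider the function $$f_{\varepsilon,\eta}(x):=\sum_{j=1}^m(-1)^{j+1}\binom{m}{j}(1+j\varepsilon)^{d-1}P((1+j\varepsilon)\eta,x),\quad x\in\mathbb{R}^d\setminus\bigcup_{j=1}^m\{(1+j\varepsilon)\eta\},$$ where $P$ is the Poisson kernel given in the context. The restriction of $f_{\varepsilon,\eta}$ to $\mathbb{S}^{d-1}$, denoted $F_\varepsilon(x\cdot\eta)$, satisfies $$|F_\varepsilon(x\cdot\eta)|\le\frac{c\,\varepsilon^{-d+1}}{(1+\varepsilon^{-1}\rho(x,\eta))^{m+d-1}}\quad\text{for all }x\in\mathbb{S}^{d-1},$$ and $$\int_{\mathbb{S}^{d-1}}F_\varepsilon(x\cdot\eta)\,d\sigma(x)=1.$$ Furthermore, with $a_j:=1+j\varepsilon$, the function $f_{\varepsilon,\eta}$ can be represented, with real constants $b_j,c_j$, in the form $$f_{\varepsilon,\eta}(x)=\sum_{j=1}^m\frac{b_j}{|x-a_j\eta|^{d-2}}+\sum_{j=1}^m c_j(\eta\cdot\nabla)\Big(\frac{1}{|x-a_j\eta|^{d-2}}\Big)\quad\text{if }d>2,$$ or $$f_{\varepsilon,\eta}(x)=b_0+\sum_{j=1}^m c_j(\eta\cdot\nabla)\ln\frac{1}{|x-a_j\eta|}\quad\text{if }d=2.$$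
   Context: $|\cdot|$ is the Euclidean norm and $x\cdot y$ the dot product on $\mathbb{R}^d$; $\mathbb{S}^{d-1}$ is the unit sphere in $\mathbb{R}^d$; $\rho(x,\eta):=\arccos(x\cdot\eta)$ is the geodesic distance on $\mathbb{S}^{d-1}$; $\sigma$ is the Lebesgue (surface) measure on $\mathbb{S}^{d-1}$, with total mass $\omega_d:=2\pi^{d/2}/\Gamma(d/2)$. $\eta\cdot\nabla$ is the directional derivative (in $x$) in direction $\eta$. The Poisson kernel for the ball of radius $a>1$ is $$P(y,x)=\frac{1}{a\,\omega_d}\,\frac{a^2-|x|^2}{|x-y|^d},\quad |y|=a,$$ and this formula is used for all $x\ne y$. The restriction of $f_{\varepsilon,\eta}$ to the sphere depends on $x$ only through $x\cdot\eta$, hence the notation $F_\varepsilon(x\cdot\eta)$. *)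

theory Defs
  imports "HOL-Analysis.Analysis"
begin

text \<open>The dimension $d$ is \<open>CARD('n)\<close>; points of $\mathbb{R}^d$ have type \<open>real ^ 'n\<close>.\<close>

definition sphere_area :: "nat \<Rightarrow> real" where
  "sphere_area d = 2 * pi powr (real d / 2) / Gamma (real d / 2)"

text \<open>
  Surface measure on the unit sphere, defined by polar coordinates: the measure of a Borel set
  \<open>A\<close> of the sphere is $d$ times the volume of the cone of all \<open>t *\<^sub>R x\<close> with \<open>0 < t \<le> 1\<close>
  and \<open>x \<in> A\<close>.
\<close>

definition sphere_measure :: "(real ^ 'n) measure" where
  "sphere_measure =
     scale_measure (of_nat CARD('n))
       (distr (restrict_space lborel (cball 0 1 - {0})) (restrict_space borel (sphere 0 1))
          (\<lambda>x. x /\<^sub>R norm x))"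

lemma space_sphere_measure: "space (sphere_measure :: (real ^ 'n) measure) = sphere 0 1"
  and sets_sphere_measure:
    "sets (sphere_measure :: (real ^ 'n) measure) = sets (restrict_space borel (sphere 0 1))"
  by (simp_all add: sphere_measure_def space_restrict_space space_scale_measure)

lemma radial_projection_measurable:
  "(\<lambda>x. x /\<^sub>R norm x) \<in>
     measurable (restrict_space lborel (cball 0 1 - {0 :: real ^ 'n})) (restrict_space borel (sphere 0 1))"
  by (rule measurable_restrict_space2)
     (auto simp: space_restrict_space intro!: measurable_restrict_space1)

lemma emeasure_sphere_measure:
  fixes A :: "(real ^ 'n) set"
  assumes "A \<in> sets borel" "A \<subseteq> sphere 0 1"
  shows "emeasure sphere_measure A =
    of_nat CARD('n) * emeasure lborel {x \<in> cball 0 1 - {0}. x /\<^sub>R norm x \<in> A}"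
proof -
  let ?B = "cball 0 1 - {0 :: real ^ 'n}"
  have A: "A \<in> sets (restrict_space borel (sphere 0 1))"
    using assms by (auto simp: sets_restrict_space_iff)
  have eq: "(\<lambda>x. x /\<^sub>R norm x) -` A \<inter> ?B = {x \<in> ?B. x /\<^sub>R norm x \<in> A}"
    by auto
  have "emeasure (restrict_space lborel ?B) {x \<in> ?B. x /\<^sub>R norm x \<in> A} =
      emeasure lborel {x \<in> ?B. x /\<^sub>R norm x \<in> A}"
    by (rule emeasure_restrict_space) auto
  thus ?thesis
    unfolding sphere_measure_def using A radial_projection_measurable[where 'n = 'n]
    by (simp add: emeasure_distr space_restrict_space eq cong: conj_cong)
qed

lemma emeasure_sphere_measure_space:
  "emeasure sphere_measure (sphere 0 1 :: (real ^ 'n) set) = ennreal (sphere_area CARD('n))"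
proof -
  let ?d = "real CARD('n)"
  have "{x \<in> cball 0 1 - {0 :: real ^ 'n}. x /\<^sub>R norm x \<in> sphere 0 1} = cball 0 1 - {0}"
    by auto
  hence "emeasure sphere_measure (sphere 0 1 :: (real ^ 'n) set) =
      of_nat CARD('n) * emeasure lborel (cball 0 1 - {0 :: real ^ 'n})"
    by (subst emeasure_sphere_measure) auto
  also have "emeasure lborel (cball 0 1 - {0 :: real ^ 'n}) = emeasure lborel (cball 0 1 :: (real ^ 'n) set)"
    by (subst emeasure_Diff) auto
  also have "\<dots> = ennreal (unit_ball_vol ?d)"
    by (simp add: emeasure_cball)
  also have "of_nat CARD('n) * \<dots> = ennreal (?d * unit_ball_vol ?d)"
    by (simp add: ennreal_mult ennreal_of_nat_eq_real_of_nat)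
  also have "?d * unit_ball_vol ?d = sphere_area CARD('n)"
  proof -
    have "Gamma (?d / 2 + 1) = ?d / 2 * Gamma (?d / 2)"
    proof (rule Gamma_plus1)
      have "?d / 2 > 0" by simp
      thus "?d / 2 \<notin> \<int>\<^sub>\<le>\<^sub>0" by (metis nonpos_Ints_nonpos not_le)
    qed
    thus ?thesis
      by (simp only: unit_ball_vol_def sphere_area_def) simp
  qed
  finally show ?thesis .
qed

text \<open>
  The Poisson kernel $P(y,x)$ for the ball of radius $a = |y|$; the radius is read off from the
  first argument.
\<close>

definition poisson_kernel :: "real ^ 'n \<Rightarrow> real ^ 'n \<Rightarrow> real" where
  "poisson_kernel y x =
     1 / (norm y * sphere_area CARD('n)) * ((norm y)\<^sup>2 - (norm x)\<^sup>2) / norm (x - y) ^ CARD('n)"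

definition sphere_dist :: "real ^ 'n \<Rightarrow> real ^ 'n \<Rightarrow> real" where
  "sphere_dist x y = arccos (x \<bullet> y)"

definition dir_deriv :: "real ^ 'n \<Rightarrow> (real ^ 'n \<Rightarrow> real) \<Rightarrow> real ^ 'n \<Rightarrow> real" where
  "dir_deriv v g x = deriv (\<lambda>t. g (x + t *\<^sub>R v)) 0"

definition poisson_comb :: "nat \<Rightarrow> real \<Rightarrow> real ^ 'n \<Rightarrow> real ^ 'n \<Rightarrow> real" where
  "poisson_comb m \<epsilon> \<eta> x =
     (\<Sum>j = 1..m. (- 1) ^ (j + 1) * real (m choose j) * (1 + real j * \<epsilon>) ^ (CARD('n) - 1) *
        poisson_kernel ((1 + real j * \<epsilon>) *\<^sub>R \<eta>) x)"

end

theory Submission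
  imports Defs
begin

text \<open>
  On the sphere the combination is, up to division by the area of the sphere, the sum over
  \<open>j = 1, ..., m\<close> of \<open>(-1)\<^bsup>j+1\<^esup> (m choose j) g(j \<epsilon>)\<close>, where
  \<open>g(s) = (1+s)\<^bsup>d-2\<^esup> s (2+s) / |x - (1+s) \<eta>|\<^sup>d\<close>.

  \<^bold>\<open>Decay.\<close> As \<open>g(0) = 0\<close> for \<open>x \<noteq> \<eta>\<close>, the sum is up to sign an \<open>m\<close>-th finite difference of \<open>g\<close> at 0.
  Let \<open>\<delta> = |x - \<eta>|\<close>. Then \<open>|x - (1+s) \<eta>|\<^sup>2 = \<delta>\<^sup>2 (1+s) + s\<^sup>2\<close>, and the substitution \<open>s = \<delta> u\<close>
  turns \<open>g\<close> into \<open>\<delta>\<^bsup>-(d-1)\<^esup> G(\<delta>, u)\<close> with a function \<open>G\<close> that is smooth for \<open>0 \<le> \<delta> \<le> 2\<close> and \<open>u \<ge> 0\<close>.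
  For \<open>\<epsilon> \<le> \<delta>\<close> the points \<open>u = j \<epsilon> / \<delta>\<close> stay in \<open>[0, m]\<close>, so the difference is bounded by
  \<open>C \<delta>\<^bsup>-(d-1)\<^esup> (\<epsilon> / \<delta>)\<^sup>m\<close>; for \<open>\<delta> < \<epsilon>\<close> each term is \<open>O(\<epsilon>\<^bsup>-(d-1)\<^esup>)\<close>. Since the geodesic distance is
  at most \<open>4 \<delta>\<close>, both bounds have the required form (\<open>alternating_profile_sum_bound\<close>).

  \<^bold>\<open>Total mass.\<close> Let \<open>|p| < 1\<close>. The integral of \<open>(1 - |p|\<^sup>2) / |e - p|\<^sup>d\<close> over unit vectors \<open>e\<close> is the
  area of the sphere (\<open>poisson_sphere_integral\<close>), by an argument going back to Malmheden. In terms
  of the direction \<open>\<theta>\<close> in which \<open>e\<close> is seen from \<open>p\<close>, the measure \<open>(1 - |p|\<^sup>2) / |e - p|\<^sup>d d\<sigma>(e)\<close>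
  becomes \<open>(1 + q / Q) d\<sigma>(\<theta>)\<close> with \<open>q = p \<bullet> \<theta>\<close> and \<open>Q = sqrt (q\<^sup>2 + 1 - |p|\<^sup>2)\<close>, and \<open>q / Q\<close> is odd in
  \<open>\<theta>\<close>. Since the surface measure is given by volumes of cones, the substitution is carried out for
  the homogeneous extension \<open>chord_map\<close> on the unit ball, whose Jacobian determinant is computed
  in \<open>chord_map_derivative\<close>. With \<open>p = \<eta> / a\<close> each scaled kernel \<open>a\<^bsup>d-1\<^esup> P(a \<eta>, x)\<close> has integral 1,
  and the alternating binomial coefficients add up to 1.

  \<^bold>\<open>Representation.\<close> With \<open>z = x - a \<eta>\<close> one has \<open>a\<^sup>2 - |x|\<^sup>2 = - |z|\<^sup>2 - 2 a (z \<bullet> \<eta>)\<close>, which splits the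
  kernel into multiples of \<open>|z|\<^bsup>-(d-2)\<^esup>\<close> and \<open>(z \<bullet> \<eta>) / |z|\<^sup>d\<close>; the latter is a multiple of the
  derivative in direction \<open>\<eta>\<close> of \<open>|z|\<^bsup>-(d-2)\<^esup>\<close> if \<open>d > 2\<close> and of \<open>ln (1 / |z|)\<close> if \<open>d = 2\<close>.
\<close>

section \<open>The determinant of a rank one perturbation\<close>

lemma det_identity_plus_rank_one:
  fixes u w :: "real ^ 'n"
  shows "det (matrix (\<lambda>x. x + (w \<bullet> x) *\<^sub>R u)) = 1 + w \<bullet> u"
proof -
  fix k :: 'n
  obtain f :: "real ^ 'n \<Rightarrow> real ^ 'n" where f: "orthogonal_transformation f"
    and fw: "f w = norm w *\<^sub>R axis k 1"
    by (rule orthogonal_transformation_exists[of w "norm w *\<^sub>R axis k 1"]) simp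
  have linf: "linear f" using f by (simp add: orthogonal_transformation_linear)
  have inner_f: "f x \<bullet> f y = x \<bullet> y" for x y using f by (simp add: orthogonal_transformation_def)
  define L where "L = (\<lambda>x. x + (w \<bullet> x) *\<^sub>R u)"
  \<comment> \<open>In coordinates in which \<open>w\<close> points along the \<open>k\<close>-th axis, the matrix differs from the identity
    in its \<open>k\<close>-th column only.\<close>
  define M where "M = (\<lambda>y. y + (norm w * y $ k) *\<^sub>R f u)"
  have coord: "norm w * f x $ k = w \<bullet> x" for x
    using inner_f[of w x] by (simp add: fw inner_axis' mult.commute)
  have linL: "linear L" unfolding L_def
    by (rule linearI) (auto simp: algebra_simps inner_add_right scaleR_add_left)
  have linM: "linear M" unfolding M_def
    by (rule linearI) (auto simp: algebra_simps scaleR_add_left)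
  have "f \<circ> L = M \<circ> f"
    by (auto simp: fun_eq_iff L_def M_def coord linear_add[OF linf] linear_scale[OF linf])
  hence "matrix f ** matrix L = matrix M ** matrix f"
    by (metis matrix_compose linf linL linM)
  hence "det (matrix f) * det (matrix L) = det (matrix M) * det (matrix f)"
    by (metis det_mul)
  moreover have "det (matrix f) \<noteq> 0"
    using orthogonal_transformation_det[OF f] by (metis abs_zero zero_neq_one)
  ultimately have "det (matrix L) = det (matrix M)" by simp
  also have "matrix M = (\<chi> i j. if j = k then (mat 1 *v (axis k 1 + norm w *\<^sub>R f u)) $ i else mat 1 $ i $ j)"
    unfolding matrix_vector_mul_lid by (auto simp: vec_eq_iff matrix_def M_def axis_def mat_def)
  also have "det \<dots> = 1 + norm w * f u $ k"
    by (subst cramer_lemma) (simp add: axis_def)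
  finally show ?thesis by (simp add: coord L_def)
qed

section \<open>The chord map of an interior point of the ball\<close>

text \<open>
  For \<open>p\<close> inside the unit ball and a unit vector \<open>e\<close>, the chord map replaces \<open>e\<close> by the direction
  in which \<open>e\<close> is seen from \<open>p\<close>. It is extended from the sphere to the whole space as a
  norm-preserving map that is positively homogeneous of degree 1, because the surface measure is
  given by volumes of cones.
\<close>

definition chord_map :: "real ^ 'n \<Rightarrow> real ^ 'n \<Rightarrow> real ^ 'n" where
  "chord_map p x = norm x *\<^sub>R sgn (sgn x - p)"

lemma chord_vector_nonzero:
  fixes p x :: "'a::real_inner"
  assumes "norm p < 1" "x \<noteq> 0"
  shows "sgn x - p \<noteq> 0" "x - norm x *\<^sub>R p \<noteq> 0"
proof -
  show "sgn x - p \<noteq> 0" using assms by (metis eq_iff_diff_eq_0 norm_sgn less_irrefl)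
  have "x - norm x *\<^sub>R p = norm x *\<^sub>R (sgn x - p)"
    using assms by (simp add: sgn_div_norm algebra_simps)
  thus "x - norm x *\<^sub>R p \<noteq> 0" using \<open>sgn x - p \<noteq> 0\<close> assms by simp
qed

lemma chord_map_alt:
  fixes p x :: "real ^ 'n"
  assumes "x \<noteq> 0"
  shows "chord_map p x = (norm x / norm (x - norm x *\<^sub>R p)) *\<^sub>R (x - norm x *\<^sub>R p)"
proof -
  have "x - norm x *\<^sub>R p = norm x *\<^sub>R (sgn x - p)"
    using assms by (simp add: sgn_div_norm algebra_simps)
  thus ?thesis using assms by (simp add: chord_map_def sgn_div_norm divide_inverse mult.commute)
qed

text \<open>
  With \<open>T y = y - |y| p\<close> and \<open>s y = |y| / |T y|\<close> the chord map is \<open>s T\<close>. As \<open>T\<close> is homogeneous of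
  degree 1 and \<open>s\<close> of degree 0, \<open>T' x = T x\<close> and \<open>s' x = 0\<close> at the point \<open>x\<close>, so the derivative
  factors into \<open>T'\<close>, a scaling and a rank one perturbation of the identity with determinant 1.
\<close>

lemma chord_map_derivative:
  fixes p x :: "real ^ 'n"
  assumes p: "norm p < 1" and x: "x \<noteq> 0"
  obtains D where "(chord_map p has_derivative D) (at x)"
    "det (matrix D) = (1 - p \<bullet> sgn x) / norm (sgn x - p) ^ CARD('n)"
proof -
  define T where "T = (\<lambda>y. y - norm y *\<^sub>R p)"
  define T' where "T' = (\<lambda>v. v - (sgn x \<bullet> v) *\<^sub>R p)"
  have Tx: "T x \<noteq> 0" using chord_vector_nonzero[OF p x] by (simp add: T_def)
  have dn: "(norm has_derivative (\<lambda>v. sgn y \<bullet> v)) (at y)" if "y \<noteq> 0" for y :: "real ^ 'n"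
    using has_derivative_norm[OF that] by (simp add: inner_commute)
  have dT: "(T has_derivative T') (at x)"
    unfolding T_def T'_def by (rule derivative_eq_intros dn[OF x] refl | simp)+
  have dnT: "((\<lambda>y. norm (T y)) has_derivative (\<lambda>v. sgn (T x) \<bullet> T' v)) (at x)"
    using has_derivative_compose[OF dT dn[OF Tx]] by (simp add: o_def)
  define s where "s = (\<lambda>y. norm y / norm (T y))"
  define s' where "s' = (\<lambda>v. ((sgn x \<bullet> v) * norm (T x) - norm x * (sgn (T x) \<bullet> T' v)) / (norm (T x) * norm (T x)))"
  have ds: "(s has_derivative s') (at x)"
    unfolding s_def s'_def by (rule has_derivative_divide'[OF dn[OF x] dnT]) (use Tx in simp)
  have T'x: "T' x = T x" using x by (simp add: T'_def T_def sgn_div_norm dot_square_norm power2_eq_square)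
  have sgn_inner: "sgn y \<bullet> y = norm y" for y :: "real ^ 'n"
    by (cases "y = 0") (simp_all add: sgn_div_norm dot_square_norm power2_eq_square)
  have s'x: "s' x = 0" by (simp add: s'_def T'x sgn_inner)
  have lins': "linear s'" using ds by (rule has_derivative_linear)
  have linT': "linear T'" using dT by (rule has_derivative_linear)
  define w where "w = adjoint s' 1"
  have w: "s' v = w \<bullet> v" for v
    using adjoint_works[OF lins', of v 1] by (simp add: w_def inner_commute)
  have sx: "s x > 0" using x Tx by (simp add: s_def)
  define R where "R = (\<lambda>v. v + ((w /\<^sub>R s x) \<bullet> v) *\<^sub>R x)"
  define D where "D = T' \<circ> (\<lambda>v. s x *\<^sub>R v) \<circ> R"
  have linR: "linear R" unfolding R_def
    by (rule linearI) (auto simp: algebra_simps inner_add_right scaleR_add_left)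
  have "((\<lambda>y. s y *\<^sub>R T y) has_derivative (\<lambda>v. s x *\<^sub>R T' v + s' v *\<^sub>R T x)) (at x)"
    by (rule has_derivative_scaleR[OF ds dT])
  also have "(\<lambda>v. s x *\<^sub>R T' v + s' v *\<^sub>R T x) = D"
    using sx by (auto simp: fun_eq_iff D_def R_def w T'x linear_add[OF linT'] linear_scale[OF linT'] scaleR_add_right)
  finally have dU: "((\<lambda>y. s y *\<^sub>R T y) has_derivative D) (at x)" .
  have "(chord_map p has_derivative D) (at x)"
  proof (rule has_derivative_transform_within_open[OF dU])
    show "open (- {0 :: real ^ 'n})" by auto
  qed (use x in \<open>auto simp: chord_map_alt s_def T_def\<close>)
  moreover have "det (matrix D) = (1 - p \<bullet> sgn x) / norm (sgn x - p) ^ CARD('n)"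
  proof -
    have "T' = (\<lambda>v. v + (sgn x \<bullet> v) *\<^sub>R (- p))" by (auto simp: T'_def)
    hence detT: "det (matrix T') = 1 - p \<bullet> sgn x"
      using det_identity_plus_rank_one[of "sgn x" "- p"] by (simp add: inner_commute)
    have detR: "det (matrix R) = 1"
      unfolding R_def det_identity_plus_rank_one using s'x by (simp add: w)
    have dets: "det (matrix (\<lambda>v :: real ^ 'n. s x *\<^sub>R v)) = s x ^ CARD('n)"
      using det_matrix_scaleR[of "s x"] by simp
    have "norm (T x) = norm x * norm (sgn x - p)"
    proof -
      have "T x = norm x *\<^sub>R (sgn x - p)" using x by (simp add: T_def sgn_div_norm algebra_simps)
      thus ?thesis by simp
    qed
    hence "s x = 1 / norm (sgn x - p)" using x by (simp add: s_def)
    moreover have "matrix D = matrix T' ** matrix (\<lambda>v. s x *\<^sub>R v) ** matrix R"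
      unfolding D_def
      by (simp add: matrix_compose linR linT' linear_compose linear_compose_scale_right
          matrix_mul_assoc o_assoc linear_scaleR)
    ultimately show ?thesis by (simp add: det_mul detT detR dets power_divide)
  qed
  ultimately show ?thesis by (rule that)
qed

lemma abs_inner_less_chord_root:
  fixes p :: "'a::real_inner"
  assumes p: "norm p < 1"
  shows "\<bar>p \<bullet> y\<bar> < sqrt ((p \<bullet> y)\<^sup>2 + 1 - (norm p)\<^sup>2)"
proof -
  have "(norm p)\<^sup>2 < 1" using p by (simp add: abs_square_less_1)
  hence "sqrt ((p \<bullet> y)\<^sup>2) < sqrt ((p \<bullet> y)\<^sup>2 + 1 - (norm p)\<^sup>2)"
    by (intro real_sqrt_less_mono) simp
  thus ?thesis by simp
qed

lemma inner_unit_vector_less_1: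
  fixes p e :: "'a::real_inner"
  assumes "norm p < 1" "norm e = 1"
  shows "p \<bullet> e < 1"
  using norm_cauchy_schwarz[of p e] assms by simp

text \<open>
  The line through \<open>p\<close> in the direction \<open>\<theta> = sgn (e - p)\<close> meets the unit sphere at \<open>p + l \<theta>\<close> where
  \<open>l\<^sup>2 + 2 q l + |p|\<^sup>2 - 1 = 0\<close> and \<open>q = p \<bullet> \<theta>\<close>; the positive root is \<open>|e - p|\<close>.
\<close>

lemma chord_root:
  fixes p e :: "'a::real_inner"
  assumes p: "norm p < 1" and e: "norm e = 1"
  defines "q \<equiv> p \<bullet> sgn (e - p)"
  shows "sqrt (q\<^sup>2 + 1 - (norm p)\<^sup>2) = (1 - p \<bullet> e) / norm (e - p)"
    "q = (p \<bullet> e - (norm p)\<^sup>2) / norm (e - p)"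
    "sqrt (q\<^sup>2 + 1 - (norm p)\<^sup>2) - q = norm (e - p)"
proof -
  have ne: "e - p \<noteq> 0" using assms by auto
  define l where "l = norm (e - p)"
  have l: "l > 0" using ne by (simp add: l_def)
  have l2: "l\<^sup>2 = 1 - 2 * (p \<bullet> e) + (norm p)\<^sup>2"
    using e by (simp add: l_def power2_norm_eq_inner inner_diff inner_commute norm_eq_1)
  show q: "q = (p \<bullet> e - (norm p)\<^sup>2) / norm (e - p)"
    by (simp add: q_def sgn_div_norm inner_diff_right power2_norm_eq_inner divide_inverse mult.commute)
  have "q\<^sup>2 + 1 - (norm p)\<^sup>2 = ((p \<bullet> e - (norm p)\<^sup>2)\<^sup>2 + (1 - (norm p)\<^sup>2) * l\<^sup>2) / l\<^sup>2"
    using l unfolding q l_def[symmetric] by (simp add: power_divide field_simps)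
  also have "(p \<bullet> e - (norm p)\<^sup>2)\<^sup>2 + (1 - (norm p)\<^sup>2) * l\<^sup>2 = (1 - p \<bullet> e)\<^sup>2"
    unfolding l2 by (simp add: power2_eq_square algebra_simps)
  finally have "q\<^sup>2 + 1 - (norm p)\<^sup>2 = ((1 - p \<bullet> e) / l)\<^sup>2" by (simp add: power_divide)
  thus Q: "sqrt (q\<^sup>2 + 1 - (norm p)\<^sup>2) = (1 - p \<bullet> e) / norm (e - p)"
    using l inner_unit_vector_less_1[OF p e] by (simp add: l_def)
  have "sqrt (q\<^sup>2 + 1 - (norm p)\<^sup>2) - q = (1 - p \<bullet> e) / l - (p \<bullet> e - (norm p)\<^sup>2) / l"
    using Q q by (simp add: l_def)
  also have "\<dots> = l\<^sup>2 / l" unfolding l2 by (simp add: diff_divide_distrib[symmetric])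
  finally have "sqrt (q\<^sup>2 + 1 - (norm p)\<^sup>2) - q = l\<^sup>2 / l" .
  thus "sqrt (q\<^sup>2 + 1 - (norm p)\<^sup>2) - q = norm (e - p)" using l by (simp add: power2_eq_square l_def)
qed

lemma norm_chord_map:
  assumes "norm p < 1" "x \<noteq> 0"
  shows "norm (chord_map p x) = norm x"
  using chord_vector_nonzero[OF assms] by (simp add: chord_map_def norm_sgn)

lemma sgn_chord_map:
  fixes p x :: "real ^ 'n"
  assumes "x \<noteq> 0"
  shows "sgn (chord_map p x) = sgn (sgn x - p)"
proof -
  have "sgn (sgn z) = sgn z" for z :: "real ^ 'n"
    by (cases "z = 0") (simp_all add: sgn_div_norm)
  thus ?thesis using assms by (simp add: chord_map_def sgn_scaleR)
qed

lemma chord_map_bij: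
  fixes p :: "real ^ 'n"
  assumes p: "norm p < 1"
  shows "inj_on (chord_map p) (cball 0 1 - {0})"
    "chord_map p ` (cball 0 1 - {0}) = cball 0 1 - {0}"
proof -
  \<comment> \<open>\<open>L \<theta>\<close> is the distance from \<open>p\<close> to the sphere in direction \<open>\<theta>\<close>, and \<open>V\<close> is the inverse of
    the chord map.\<close>
  define L where "L = (\<lambda>\<theta>. sqrt ((p \<bullet> \<theta>)\<^sup>2 + 1 - (norm p)\<^sup>2) - p \<bullet> \<theta>)"
  define V where "V = (\<lambda>y. norm y *\<^sub>R (p + L (sgn y) *\<^sub>R sgn y))"
  have VU: "V (chord_map p x) = x" if "x \<noteq> 0" for x
  proof -
    have "L (sgn (sgn x - p)) = norm (sgn x - p)"
      using chord_root(3)[OF p, of "sgn x"] that by (simp add: L_def norm_sgn)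
    thus ?thesis using chord_vector_nonzero(1)[OF p that] that
      by (simp add: V_def sgn_chord_map norm_chord_map[OF p that]) (simp add: sgn_div_norm)
  qed
  show "inj_on (chord_map p) (cball 0 1 - {0})"
    by (rule inj_on_inverseI[of _ V]) (auto simp: VU)
  show "chord_map p ` (cball 0 1 - {0}) = cball 0 1 - {0}"
  proof
    show "chord_map p ` (cball 0 1 - {0}) \<subseteq> cball 0 1 - {0}"
      using norm_chord_map[OF p] by (auto simp: mem_cball_0) (metis norm_eq_zero)
    show "cball 0 1 - {0} \<subseteq> chord_map p ` (cball 0 1 - {0})"
    proof
      fix y :: "real ^ 'n" assume y: "y \<in> cball 0 1 - {0}"
      define \<theta> where "\<theta> = sgn y"
      define q where "q = p \<bullet> \<theta>"
      have \<theta>: "norm \<theta> = 1" using y by (simp add: \<theta>_def norm_sgn)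
      have Q: "\<bar>q\<bar> < L \<theta> + q" using abs_inner_less_chord_root[OF p, of \<theta>] by (simp add: L_def q_def)
      have "(norm p)\<^sup>2 < 1" using p by (simp add: abs_square_less_1)
      hence "0 \<le> q\<^sup>2 + 1 - (norm p)\<^sup>2" by (smt (verit) zero_le_power2)
      hence "(L \<theta> + q)\<^sup>2 = q\<^sup>2 + 1 - (norm p)\<^sup>2" by (simp add: L_def q_def)
      moreover have "(norm (p + L \<theta> *\<^sub>R \<theta>))\<^sup>2 = (norm p)\<^sup>2 + 2 * L \<theta> * q + (L \<theta>)\<^sup>2"
        using \<theta> by (simp add: power2_norm_eq_inner inner_add inner_commute q_def norm_eq_1) (simp add: power2_eq_square)
      ultimately have "(norm (p + L \<theta> *\<^sub>R \<theta>))\<^sup>2 = 1" by (simp add: power2_eq_square algebra_simps)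
      hence n1: "norm (p + L \<theta> *\<^sub>R \<theta>) = 1" by (metis abs_norm_cancel abs_square_eq_1)
      have nV: "norm (V y) = norm y" using n1 by (simp add: V_def \<theta>_def)
      have "sgn (V y) = p + L \<theta> *\<^sub>R \<theta>"
        using n1 y by (simp add: V_def \<theta>_def[symmetric] sgn_scaleR) (simp add: sgn_div_norm)
      hence "chord_map p (V y) = norm y *\<^sub>R sgn (L \<theta> *\<^sub>R \<theta>)" by (simp add: chord_map_def nV)
      also have "sgn (L \<theta> *\<^sub>R \<theta>) = \<theta>" using Q \<theta> by (simp add: sgn_scaleR) (simp add: sgn_div_norm)
      also have "norm y *\<^sub>R \<theta> = y" using y by (simp add: \<theta>_def sgn_div_norm)
      finally have "chord_map p (V y) = y" .
      moreover have "V y \<in> cball 0 1 - {0}" using y nV by (auto simp: mem_cball_0)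
      ultimately show "y \<in> chord_map p ` (cball 0 1 - {0})" by (metis imageI)
    qed
  qed
qed

section \<open>The Poisson integral over the ball\<close>

lemma has_bochner_integral_lborel_neg:
  fixes f :: "'a::euclidean_space \<Rightarrow> real"
  assumes "has_bochner_integral lborel f i"
  shows "has_bochner_integral lborel (\<lambda>x. f (- x)) i"
proof -
  have eq: "(lborel :: 'a measure) = distr lborel borel uminus"
    using lborel_affine[of "-1" "0::'a"] by (simp add: density_1)
  have [measurable]: "f \<in> borel_measurable borel"
    using assms by (auto simp: has_bochner_integral_iff)
  have "integrable (distr lborel borel uminus) f" "integral\<^sup>L (distr lborel borel uminus) f = i"
    using assms unfolding eq[symmetric] by (auto simp: has_bochner_integral_iff)
  thus ?thesis
    by (simp add: integrable_distr_eq integral_distr has_bochner_integral_iff)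
qed

lemma has_bochner_integral_completion_iff:
  fixes f :: "'a \<Rightarrow> 'b::{banach, second_countable_topology}"
  assumes "f \<in> borel_measurable M"
  shows "has_bochner_integral (completion M) f i \<longleftrightarrow> has_bochner_integral M f i"
  using assms by (simp add: has_bochner_integral_iff integrable_completion integral_completion)

text \<open>
  The quotient \<open>(p \<bullet> \<theta>) / Q\<close>, where \<open>Q\<close> is the square root, is odd in \<open>\<theta>\<close>, so only the constant 1
  contributes to the integral over the ball.
\<close>

lemma chord_density_integral:
  fixes p :: "'a::euclidean_space"
  assumes p: "norm p < 1"
  defines "h \<equiv> (\<lambda>y. 1 + (p \<bullet> sgn y) / sqrt ((p \<bullet> sgn y)\<^sup>2 + 1 - (norm p)\<^sup>2))"
  shows "has_bochner_integral lborel (\<lambda>y. indicator (cball 0 1 - {0}) y * h y) (unit_ball_vol (real DIM('a)))"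
proof -
  define f where "f = (\<lambda>y. indicator (cball 0 1 - {0::'a}) y * h y)"
  have h_bound: "norm (h y) \<le> 2" for y
  proof -
    define Q where "Q = sqrt ((p \<bullet> sgn y)\<^sup>2 + 1 - (norm p)\<^sup>2)"
    have Q: "\<bar>p \<bullet> sgn y\<bar> < Q" using abs_inner_less_chord_root[OF p, of "sgn y"] by (simp add: Q_def)
    hence "\<bar>(p \<bullet> sgn y) / Q\<bar> \<le> 1" by (subst abs_divide) (auto simp: divide_le_eq_1)
    hence "\<bar>1 + (p \<bullet> sgn y) / Q\<bar> \<le> 2" by linarith
    thus ?thesis by (simp add: h_def Q_def[symmetric])
  qed
  have [measurable]: "(sgn :: 'a \<Rightarrow> 'a) \<in> borel_measurable borel"
    unfolding sgn_div_norm[abs_def] by measurable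
  have [measurable]: "h \<in> borel_measurable borel" unfolding h_def by measurable
  have fin: "emeasure lborel (cball 0 1 - {0::'a}) < \<infinity>"
    by (rule order.strict_trans1[OF emeasure_mono emeasure_lborel_cball_finite]) auto
  have int: "integrable lborel f"
    unfolding f_def
    using integrableI_bounded_set_indicator[where A = "cball 0 1 - {0::'a}" and M = lborel and f = h and B = 2] fin h_bound
    by simp
  define i where "i = integral\<^sup>L lborel f"
  have 1: "has_bochner_integral lborel f i" using int by (simp add: i_def has_bochner_integral_iff)
  have "has_bochner_integral lborel (\<lambda>y. f y + f (- y)) (i + i)"
    by (rule has_bochner_integral_add[OF 1 has_bochner_integral_lborel_neg[OF 1]])
  moreover have "(\<lambda>y. f y + f (- y)) = (\<lambda>y. 2 * indicator (cball 0 1 - {0}) y)"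
    by (auto simp: f_def h_def fun_eq_iff sgn_minus split: split_indicator)
  ultimately have "(LINT y|lborel. 2 * indicator (cball 0 1 - {0::'a}) y) = 2 * i"
    by (simp add: has_bochner_integral_iff)
  hence "i = measure lborel (cball 0 1 - {0::'a})" by simp
  also have "\<dots> = measure lborel (cball 0 1 :: 'a set)"
    using emeasure_lborel_cball_finite[of "0::'a" 1] by (subst measure_Diff) auto
  also have "\<dots> = unit_ball_vol (real DIM('a))" by (simp add: content_cball)
  finally show ?thesis using 1 by (simp add: f_def)
qed

text \<open>
  The index type is well-ordered, as it is in the Jacobian change of variables theorem.
  The Jacobian determinant of the chord map times the density \<open>h\<close> along the chord map is the
  Poisson kernel, since \<open>h = (1 - |p|\<^sup>2) / (1 - p \<bullet> e)\<close> at the image of a unit vector \<open>e\<close>.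
\<close>

lemma poisson_ball_integral_wellorder:
  fixes p :: "real ^ 'm::{finite,wellorder}"
  assumes p: "norm p < 1"
  shows "has_bochner_integral lborel
    (\<lambda>x. indicator (cball 0 1 - {0}) x * ((1 - (norm p)\<^sup>2) / norm (sgn x - p) ^ CARD('m)))
    (unit_ball_vol (real CARD('m)))"
proof -
  define S where "S = cball 0 1 - {0 :: (real, 'm) vec}"
  define h where "h = (\<lambda>y :: (real, 'm) vec. 1 + (p \<bullet> sgn y) / sqrt ((p \<bullet> sgn y)\<^sup>2 + 1 - (norm p)\<^sup>2))"
  define k where "k = (\<lambda>x :: (real, 'm) vec. (1 - (norm p)\<^sup>2) / norm (sgn x - p) ^ CARD('m))"
  define V where "V = unit_ball_vol (real CARD('m))"
  have "\<exists>D. \<forall>x\<in>S. (chord_map p has_derivative D x) (at x) \<and>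
      det (matrix (D x)) = (1 - p \<bullet> sgn x) / norm (sgn x - p) ^ CARD('m)"
    by (rule bchoice) (unfold S_def, use chord_map_derivative[OF p] in \<open>metis Diff_iff singletonI\<close>)
  then obtain D where D: "\<And>x. x \<in> S \<Longrightarrow> (chord_map p has_derivative D x) (at x)"
    and det: "\<And>x. x \<in> S \<Longrightarrow> det (matrix (D x)) = (1 - p \<bullet> sgn x) / norm (sgn x - p) ^ CARD('m)"
    by blast
  have S: "S \<in> sets lebesgue" "S \<in> sets borel" by (auto simp: S_def)
  \<comment> \<open>The change of variables theorem is about vector-valued functions; \<open>h\<close> is read as a map into
    \<open>real ^ 1\<close>.\<close>
  have "(\<lambda>x. \<bar>det (matrix (D x))\<bar> *\<^sub>R (vec (h (chord_map p x)) :: real ^ 1)) absolutely_integrable_on S \<and>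
          integral S (\<lambda>x. \<bar>det (matrix (D x))\<bar> *\<^sub>R (vec (h (chord_map p x)) :: real ^ 1)) = vec V \<longleftrightarrow>
        (\<lambda>x. vec (h x) :: real ^ 1) absolutely_integrable_on (chord_map p ` S) \<and>
          integral (chord_map p ` S) (\<lambda>x. vec (h x) :: real ^ 1) = vec V"
    by (rule has_absolute_integral_change_of_variables[OF S(1)])
       (use D chord_map_bij[OF p] in \<open>auto simp: S_def intro: has_derivative_at_withinI\<close>)
  hence cov: "(\<lambda>x. \<bar>det (matrix (D x))\<bar> * h (chord_map p x)) absolutely_integrable_on S \<and>
          integral S (\<lambda>x. \<bar>det (matrix (D x))\<bar> * h (chord_map p x)) = V \<longleftrightarrow>
        h absolutely_integrable_on S \<and> integral S h = V"
    using chord_map_bij(2)[OF p] by (simp add: absolutely_integrable_on_1_iff integral_on_1_eq S_def)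
  have eq: "\<bar>det (matrix (D x))\<bar> * h (chord_map p x) = k x" if "x \<in> S" for x
  proof -
    have x: "x \<noteq> 0" and e: "norm (sgn x) = 1" using that by (auto simp: S_def norm_sgn)
    have ne: "sgn x - p \<noteq> 0" using chord_vector_nonzero(1)[OF p x] .
    have c: "p \<bullet> sgn x < 1" using inner_unit_vector_less_1[OF p e] .
    have "h (chord_map p x) = 1 + (p \<bullet> sgn x - (norm p)\<^sup>2) / (1 - p \<bullet> sgn x)"
      unfolding h_def sgn_chord_map[OF x] chord_root(1)[OF p e] 
      using ne by (simp add: chord_root(2)[OF p e])
    also have "\<dots> = (1 - (norm p)\<^sup>2) / (1 - p \<bullet> sgn x)" using c by (simp add: field_simps)
    finally show ?thesis using c ne by (simp add: det[OF that] k_def abs_mult)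
  qed
  have [measurable]: "(sgn :: (real, 'm) vec \<Rightarrow> (real, 'm) vec) \<in> borel_measurable borel"
    unfolding sgn_div_norm[abs_def] by measurable
  have "has_bochner_integral lborel (\<lambda>y. indicator S y *\<^sub>R h y) V"
    using chord_density_integral[OF p] by (simp add: S_def h_def V_def)
  hence "has_bochner_integral lebesgue (\<lambda>y. indicator S y *\<^sub>R h y) V"
    by (subst has_bochner_integral_completion_iff) (auto simp: has_bochner_integral_iff)
  hence h: "h absolutely_integrable_on S" and hV: "set_lebesgue_integral lebesgue S h = V"
    by (simp_all add: set_integrable_def has_bochner_integral_iff set_lebesgue_integral_def)
  moreover have "integral S h = V"
    using set_lebesgue_integral_eq_integral(2)[OF h] hV by simp
  ultimately have "(\<lambda>x. \<bar>det (matrix (D x))\<bar> * h (chord_map p x)) absolutely_integrable_on S"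
    "integral S (\<lambda>x. \<bar>det (matrix (D x))\<bar> * h (chord_map p x)) = V"
    using cov by auto
  hence k: "k absolutely_integrable_on S" "integral S k = V"
    by (simp_all add: eq cong: set_integrable_cong integral_cong)
  have "integrable lebesgue (\<lambda>x. indicator S x *\<^sub>R k x)" "(LINT x|lebesgue. indicator S x *\<^sub>R k x) = V"
    using k set_lebesgue_integral_eq_integral(2)[OF k(1)] by (auto simp: set_integrable_def set_lebesgue_integral_def)
  moreover have [measurable]: "k \<in> borel_measurable borel" unfolding k_def by measurable
  have "(\<lambda>x. indicator S x *\<^sub>R k x) \<in> borel_measurable borel" using S by measurable
  ultimately show ?thesis
    by (simp add: integrable_completion integral_completion has_bochner_integral_iff S_def k_def V_def)
qed

section \<open>Transfer to arbitrary finite index types\<close>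

text \<open>
  A well-ordered copy of a finite index type: the initial segment of the natural numbers with the
  same cardinality. It transfers the integral to an arbitrary finite index type.
\<close>

typedef (overloaded) ('a::finite) idx = "{..<CARD('a)}"
  by (rule exI[of _ 0]) simp

instantiation idx :: (finite) wellorder
begin

definition less_eq_idx :: "'a idx \<Rightarrow> 'a idx \<Rightarrow> bool" where
  "less_eq_idx x y \<longleftrightarrow> Rep_idx x \<le> Rep_idx y"

definition less_idx :: "'a idx \<Rightarrow> 'a idx \<Rightarrow> bool" where
  "less_idx x y \<longleftrightarrow> Rep_idx x < Rep_idx y"

instance
proof
  fix P :: "'a idx \<Rightarrow> bool" and a
  assume step: "\<And>x. (\<And>y. y < x \<Longrightarrow> P y) \<Longrightarrow> P x"
  show "P a"
    by (induction a rule: measure_induct_rule[of Rep_idx]) (rule step, simp add: less_idx_def)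
qed (auto simp: less_eq_idx_def less_idx_def Rep_idx_inject)

end

lemma bij_betw_Rep_idx: "bij_betw Rep_idx (UNIV :: ('a::finite) idx set) {..<CARD('a)}"
  by (metis type_definition.Rep_inject type_definition.Rep_range type_definition_idx bij_betw_def inj_on_def)

instance idx :: (finite) finite
  by standard (metis bij_betw_Rep_idx bij_betw_finite finite_lessThan)

lemma card_idx: "CARD('a::finite idx) = CARD('a)"
  using bij_betw_same_card[OF bij_betw_Rep_idx] by simp

lemma lborel_distr_permute:
  fixes \<pi> :: "'m::finite \<Rightarrow> 'n::finite"
  assumes \<pi>: "bij \<pi>"
  shows "distr lborel borel (\<lambda>x :: real ^ 'n. \<chi> i. x $ \<pi> i) = (lborel :: (real ^ 'm) measure)"
proof (rule lborel_eqI[symmetric])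
  define \<Phi> where "\<Phi> = (\<lambda>x :: real ^ 'n. \<chi> i. x $ \<pi> i)"
  have surj: "\<pi> (inv \<pi> j) = j" for j using \<pi> by (simp add: bij_is_surj surj_f_inv_f)
  have inj: "inv \<pi> (\<pi> i) = i" for i using \<pi> by (simp add: bij_is_inj)
  have "linear \<Phi>" unfolding \<Phi>_def by (rule linearI) (auto simp: vec_eq_iff)
  hence [measurable]: "\<Phi> \<in> borel_measurable borel"
    by (intro borel_measurable_continuous_onI linear_continuous_on linear_conv_bounded_linear[THEN iffD1])
  fix l u :: "real ^ 'm"
  assume le: "\<And>b. b \<in> Basis \<Longrightarrow> l \<bullet> b \<le> u \<bullet> b"
  hence le': "l $ i \<le> u $ i" for i by (metis axis_in_Basis_iff inner_axis inner_real_def mult.right_neutral Basis_real_def singletonI)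
  define l' u' :: "real ^ 'n" where "l' = (\<chi> j. l $ inv \<pi> j)" and "u' = (\<chi> j. u $ inv \<pi> j)"
  have "\<Phi> -` box l u = box l' u'"
    by (auto simp: mem_box_cart \<Phi>_def l'_def u'_def) (metis surj inj)+
  hence "emeasure (distr lborel borel \<Phi>) (box l u) = emeasure lborel (box l' u')"
    by (simp add: emeasure_distr)
  also have "\<dots> = ennreal (\<Prod>b\<in>Basis. (u' - l') \<bullet> b)"
    by (subst emeasure_lborel_box) (auto simp: Basis_vec_def inner_axis l'_def u'_def le')
  also have "(\<Prod>b\<in>Basis. (u' - l') \<bullet> b) = (\<Prod>j\<in>UNIV. (u' - l') $ j)"
    by (subst prod.reindex_bij_betw[symmetric, of "\<lambda>j. axis j 1" UNIV Basis])
       (auto simp: inner_axis Basis_vec_def bij_betw_def inj_on_def axis_eq_axis)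
  also have "\<dots> = (\<Prod>i\<in>UNIV. (u - l) $ i)"
    by (subst prod.reindex_bij_betw[symmetric, of \<pi> UNIV UNIV]) (use \<pi> in \<open>auto simp: l'_def u'_def inj\<close>)
  also have "\<dots> = (\<Prod>b\<in>Basis. (u - l) \<bullet> b)"
    by (subst prod.reindex_bij_betw[symmetric, of "\<lambda>j. axis j 1" UNIV Basis])
       (auto simp: inner_axis Basis_vec_def bij_betw_def inj_on_def axis_eq_axis)
  finally show "emeasure (distr lborel borel \<Phi>) (box l u) = ennreal (\<Prod>b\<in>Basis. (u - l) \<bullet> b)" .
qed simp

lemma poisson_ball_integral:
  fixes p :: "real ^ 'n"
  assumes p: "norm p < 1"
  shows "has_bochner_integral lborel
    (\<lambda>x. indicator (cball 0 1 - {0}) x * ((1 - (norm p)\<^sup>2) / norm (sgn x - p) ^ CARD('n)))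
    (unit_ball_vol (real CARD('n)))"
proof -
  obtain \<pi> :: "'n idx \<Rightarrow> 'n" where \<pi>: "bij \<pi>"
    using finite_same_card_bij[of "UNIV :: 'n idx set" "UNIV :: 'n set"] by (auto simp: card_idx)
  define \<Phi> where "\<Phi> = (\<lambda>x :: real ^ 'n. \<chi> i. x $ \<pi> i)"
  have inner: "\<Phi> x \<bullet> \<Phi> y = x \<bullet> y" for x y
    using sum.reindex_bij_betw[OF \<pi>, of "\<lambda>i. x $ i * y $ i"] by (simp add: inner_vec_def \<Phi>_def)
  have norm: "norm (\<Phi> x) = norm x" for x by (simp add: norm_eq_sqrt_inner inner)
  have lin: "linear \<Phi>" unfolding \<Phi>_def by (rule linearI) (auto simp: vec_eq_iff)
  hence [measurable]: "\<Phi> \<in> borel_measurable borel"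
    by (intro borel_measurable_continuous_onI linear_continuous_on linear_conv_bounded_linear[THEN iffD1])
  have sgn: "norm (sgn (\<Phi> x) - \<Phi> p) = norm (sgn x - p)" for x
    by (simp add: sgn_div_norm norm linear_scale[OF lin, symmetric] linear_diff[OF lin, symmetric] norm)
  have mem: "\<Phi> x \<in> cball 0 1 - {0} \<longleftrightarrow> x \<in> cball 0 1 - {0}" for x
    by (metis Diff_iff mem_cball_0 norm norm_eq_zero singleton_iff)
  have ind: "indicator (cball 0 1 - {0}) (\<Phi> x) = (indicator (cball 0 1 - {0}) x :: real)" for x
    using mem[of x] by (simp add: indicator_def)
  have distr: "distr lborel borel \<Phi> = lborel" unfolding \<Phi>_def by (rule lborel_distr_permute[OF \<pi>])
  define k where "k = (\<lambda>x. indicator (cball 0 1 - {0}) x * ((1 - (norm (\<Phi> p))\<^sup>2) / norm (sgn x - \<Phi> p) ^ CARD('n)))"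
  have k: "has_bochner_integral lborel k (unit_ball_vol (real CARD('n)))"
    using poisson_ball_integral_wellorder[of "\<Phi> p"] p by (simp add: k_def norm card_idx)
  hence [measurable]: "k \<in> borel_measurable borel" by (auto simp: has_bochner_integral_iff)
  have "has_bochner_integral (distr lborel borel \<Phi>) k (unit_ball_vol (real CARD('n)))"
    using k by (simp add: distr)
  hence "has_bochner_integral lborel (\<lambda>x. k (\<Phi> x)) (unit_ball_vol (real CARD('n)))"
    by (simp add: has_bochner_integral_iff integrable_distr_eq integral_distr)
  thus ?thesis by (simp add: k_def ind norm sgn)
qed

section \<open>The Poisson integral over the sphere\<close>

lemma has_bochner_integral_sphere_measure:
  fixes f :: "real ^ 'n \<Rightarrow> real"
  assumes [measurable]: "f \<in> borel_measurable borel" and nonneg: "\<And>x. f x \<ge> 0"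
    and int: "has_bochner_integral lborel (\<lambda>x. indicator (cball 0 1 - {0}) x * f (sgn x)) i"
  shows "has_bochner_integral sphere_measure f (real CARD('n) * i)"
proof -
  define B where "B = cball 0 1 - {0 :: real ^ 'n}"
  define N where "N = distr (restrict_space lborel B) (restrict_space borel (sphere 0 1)) (\<lambda>x. x /\<^sub>R norm x)"
  have proj: "(\<lambda>x. x /\<^sub>R norm x) \<in> measurable (restrict_space lborel B) (restrict_space borel (sphere 0 1))"
    unfolding B_def by (rule radial_projection_measurable)
  have fm: "f \<in> borel_measurable (restrict_space borel (sphere 0 1))"
    by (rule measurable_restrict_space1) simp
  have i: "i \<ge> 0" using int nonneg by (auto simp: has_bochner_integral_iff intro!: integral_nonneg_AE)
  have "nn_integral sphere_measure f = of_nat CARD('n) * nn_integral N f"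
    unfolding sphere_measure_def N_def B_def
    by (rule nn_integral_scale_measure) (use fm in simp)
  also have "nn_integral N f = (\<integral>\<^sup>+x. ennreal (f (x /\<^sub>R norm x)) \<partial>restrict_space lborel B)"
    unfolding N_def by (rule nn_integral_distr[OF proj]) (use fm in simp)
  also have "\<dots> = (\<integral>\<^sup>+x. ennreal (f (x /\<^sub>R norm x)) * indicator B x \<partial>lborel)"
    by (rule nn_integral_restrict_space) (simp add: B_def)
  also have "\<dots> = (\<integral>\<^sup>+x. ennreal (indicator B x * f (sgn x)) \<partial>lborel)"
    by (rule nn_integral_cong) (auto simp: sgn_div_norm split: split_indicator)
  also have "\<dots> = ennreal i"
    using int nonneg unfolding B_def[symmetric]
    by (subst nn_integral_eq_integral) (auto simp: has_bochner_integral_iff)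
  also have "of_nat CARD('n) * ennreal i = ennreal (real CARD('n) * i)"
    using i by (simp add: ennreal_mult ennreal_of_nat_eq_real_of_nat)
  finally have "nn_integral sphere_measure f = ennreal (real CARD('n) * i)" .
  thus ?thesis
    by (intro has_bochner_integral_nn_integral) (use fm i nonneg in \<open>auto simp: sphere_measure_def\<close>)
qed

lemma sphere_area_eq: "sphere_area (CARD('n::finite)) = real CARD('n) * unit_ball_vol (real CARD('n))"
proof -
  let ?d = "real CARD('n)"
  have "?d / 2 \<notin> \<int>\<^sub>\<le>\<^sub>0" by (metis nonpos_Ints_nonpos not_le zero_less_card_finite half_gt_zero of_nat_0_less_iff)
  hence "Gamma (?d / 2 + 1) = ?d / 2 * Gamma (?d / 2)" by (rule Gamma_plus1)
  thus ?thesis by (simp only: unit_ball_vol_def sphere_area_def) simp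
qed

text \<open>
  The mean value property of the Poisson kernel, with the pole inverted to the point \<open>p\<close> inside the
  ball and the integration variable on the sphere.
\<close>

proposition poisson_sphere_integral:
  fixes p :: "real ^ 'n"
  assumes p: "norm p < 1"
  shows "has_bochner_integral sphere_measure (\<lambda>x. (1 - (norm p)\<^sup>2) / norm (x - p) ^ CARD('n))
    (sphere_area CARD('n))"
proof -
  have "(norm p)\<^sup>2 < 1" using p by (simp add: abs_square_less_1)
  thus ?thesis unfolding sphere_area_eq
    by (intro has_bochner_integral_sphere_measure poisson_ball_integral[OF p]) auto
qed

section \<open>Families with uniformly bounded derivatives\<close>

text \<open>
  A family \<open>f\<close> of real functions, indexed by \<open>I\<close>, has derivatives up to order \<open>k\<close> at the points of
  \<open>J\<close>, and each of these, including the function itself, is bounded uniformly on \<open>I \<times> J\<close>.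
  The derivative at a point of \<open>J\<close> is two-sided, also at an endpoint of an interval.
\<close>

primrec uniform_derivs :: "nat \<Rightarrow> 'i set \<Rightarrow> real set \<Rightarrow> ('i \<Rightarrow> real \<Rightarrow> real) \<Rightarrow> bool" where
  "uniform_derivs 0 I J f \<longleftrightarrow> (\<exists>C. \<forall>i\<in>I. \<forall>u\<in>J. \<bar>f i u\<bar> \<le> C)"
| "uniform_derivs (Suc k) I J f \<longleftrightarrow> (\<exists>C. \<forall>i\<in>I. \<forall>u\<in>J. \<bar>f i u\<bar> \<le> C) \<and>
     (\<exists>f'. (\<forall>i\<in>I. \<forall>u\<in>J. (f i has_real_derivative f' i u) (at u)) \<and> uniform_derivs k I J f')"

lemma uniform_derivs_SucI:
  assumes "\<And>i u. i \<in> I \<Longrightarrow> u \<in> J \<Longrightarrow> \<bar>f i u\<bar> \<le> C"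
    and "\<And>i u. i \<in> I \<Longrightarrow> u \<in> J \<Longrightarrow> (f i has_real_derivative f' i u) (at u)"
    and "uniform_derivs k I J f'"
  shows "uniform_derivs (Suc k) I J f"
  unfolding uniform_derivs.simps using assms by blast

lemma uniform_derivs_Suc_D: "uniform_derivs (Suc k) I J f \<Longrightarrow> uniform_derivs k I J f"
proof (induction k arbitrary: f)
  case (Suc k)
  then obtain C f' where "\<forall>i\<in>I. \<forall>u\<in>J. \<bar>f i u\<bar> \<le> C"
    "\<forall>i\<in>I. \<forall>u\<in>J. (f i has_real_derivative f' i u) (at u)" "uniform_derivs (Suc k) I J f'"
    by (auto simp del: uniform_derivs.simps simp: uniform_derivs.simps(2)[of "Suc k"])
  thus ?case using Suc.IH[of f'] by auto
qed auto

lemma uniform_derivs_const: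
  assumes "\<And>i. i \<in> I \<Longrightarrow> \<bar>c i\<bar> \<le> C"
  shows "uniform_derivs k I J (\<lambda>i u. c i)"
proof -
  have "uniform_derivs k I J (\<lambda>i u. 0)" for k
    by (induction k) (auto intro!: exI[of _ "\<lambda>i u. 0"])
  thus ?thesis using assms
    by (cases k) (auto intro!: exI[of _ "\<lambda>i u. 0"])
qed

lemma uniform_derivs_ident:
  assumes "\<And>u. u \<in> J \<Longrightarrow> \<bar>u\<bar> \<le> C"
  shows "uniform_derivs k I J (\<lambda>i u. u)"
proof (cases k)
  case (Suc l)
  show ?thesis unfolding Suc
    by (rule uniform_derivs_SucI[where C = C and f' = "\<lambda>i u. 1"])
       (use assms uniform_derivs_const[of I "\<lambda>_. 1" 1] in auto)
qed (use assms in auto)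

lemma uniform_derivs_add:
  "uniform_derivs k I J f \<Longrightarrow> uniform_derivs k I J g \<Longrightarrow> uniform_derivs k I J (\<lambda>i u. f i u + g i u)"
proof (induction k arbitrary: f g)
  case 0
  then obtain A B where "\<forall>i\<in>I. \<forall>u\<in>J. \<bar>f i u\<bar> \<le> A" "\<forall>i\<in>I. \<forall>u\<in>J. \<bar>g i u\<bar> \<le> B" by auto
  thus ?case by (auto intro!: exI[of _ "A + B"] order.trans[OF abs_triangle_ineq] add_mono)
next
  case (Suc k)
  then obtain A B f' g' where
    *: "\<forall>i\<in>I. \<forall>u\<in>J. \<bar>f i u\<bar> \<le> A" "\<forall>i\<in>I. \<forall>u\<in>J. \<bar>g i u\<bar> \<le> B"
    "\<forall>i\<in>I. \<forall>u\<in>J. (f i has_real_derivative f' i u) (at u)" "uniform_derivs k I J f'"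
    "\<forall>i\<in>I. \<forall>u\<in>J. (g i has_real_derivative g' i u) (at u)" "uniform_derivs k I J g'"
    by auto
  show ?case
    by (rule uniform_derivs_SucI[where C = "A + B" and f' = "\<lambda>i u. f' i u + g' i u"])
       (use * Suc.IH[OF *(4,6)] in \<open>auto intro!: DERIV_add order.trans[OF abs_triangle_ineq] add_mono\<close>)
qed

lemma uniform_derivs_mult:
  "uniform_derivs k I J f \<Longrightarrow> uniform_derivs k I J g \<Longrightarrow> uniform_derivs k I J (\<lambda>i u. f i u * g i u)"
proof (induction k arbitrary: f g)
  case 0
  then obtain A B where *: "\<forall>i\<in>I. \<forall>u\<in>J. \<bar>f i u\<bar> \<le> A" "\<forall>i\<in>I. \<forall>u\<in>J. \<bar>g i u\<bar> \<le> B" by auto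
  have "\<bar>f i u * g i u\<bar> \<le> A * B" if "i \<in> I" "u \<in> J" for i u
    unfolding abs_mult using * that by (intro mult_mono) (auto intro: order.trans[OF abs_ge_zero])
  thus ?case by auto
next
  case (Suc k)
  then obtain A B f' g' where
    *: "\<forall>i\<in>I. \<forall>u\<in>J. \<bar>f i u\<bar> \<le> A" "\<forall>i\<in>I. \<forall>u\<in>J. \<bar>g i u\<bar> \<le> B"
    "\<forall>i\<in>I. \<forall>u\<in>J. (f i has_real_derivative f' i u) (at u)" "uniform_derivs k I J f'"
    "\<forall>i\<in>I. \<forall>u\<in>J. (g i has_real_derivative g' i u) (at u)" "uniform_derivs k I J g'"
    by auto
  have fg: "uniform_derivs k I J f" "uniform_derivs k I J g"
    using Suc.prems by (auto intro: uniform_derivs_Suc_D simp del: uniform_derivs.simps)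
  show ?case
  proof (rule uniform_derivs_SucI[where C = "A * B" and f' = "\<lambda>i u. f' i u * g i u + g' i u * f i u"])
    show "\<bar>f i u * g i u\<bar> \<le> A * B" if "i \<in> I" "u \<in> J" for i u
      unfolding abs_mult using * that by (intro mult_mono) (auto intro: order.trans[OF abs_ge_zero])
    show "uniform_derivs k I J (\<lambda>i u. f' i u * g i u + g' i u * f i u)"
      by (intro uniform_derivs_add Suc.IH * fg)
  qed (use * in \<open>auto intro!: DERIV_mult\<close>)
qed

lemma uniform_derivs_power:
  "uniform_derivs k I J f \<Longrightarrow> uniform_derivs k I J (\<lambda>i u. f i u ^ n)"
  by (induction n) (auto intro: uniform_derivs_mult uniform_derivs_const[where C = 1])

lemma uniform_derivs_powr:
  assumes W: "\<And>k. uniform_derivs k I J W" and pos: "\<And>i u. i \<in> I \<Longrightarrow> u \<in> J \<Longrightarrow> 1 \<le> W i u"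
  shows "uniform_derivs k I J (\<lambda>i u. W i u powr r)"
proof (induction k arbitrary: r)
  obtain B where B: "\<And>i u. i \<in> I \<Longrightarrow> u \<in> J \<Longrightarrow> W i u \<le> B"
    using W[of 0] by (auto dest: abs_le_D1)
  have bd: "\<bar>W i u powr r\<bar> \<le> max 1 B powr \<bar>r\<bar>" if "i \<in> I" "u \<in> J" for i u r
  proof -
    have "W i u powr r \<le> W i u powr \<bar>r\<bar>" using pos[OF that] by (intro powr_mono) auto
    also have "\<dots> \<le> max 1 B powr \<bar>r\<bar>" using pos[OF that] B[OF that] by (intro powr_mono2) auto
    finally show ?thesis by simp
  qed
  {
    case 0 
    show ?case using bd by (auto intro!: exI[of _ "max 1 B powr \<bar>r\<bar>"])
  next
    case (Suc k)
    obtain W' where W': "\<forall>i\<in>I. \<forall>u\<in>J. (W i has_real_derivative W' i u) (at u)" "uniform_derivs k I J W'"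
      using W[of "Suc k"] by auto
    show ?case
    proof (rule uniform_derivs_SucI[where f' = "\<lambda>i u. r * W i u powr (r - 1) * W' i u"])
      show "\<bar>W i u powr r\<bar> \<le> max 1 B powr \<bar>r\<bar>" if "i \<in> I" "u \<in> J" for i u by (rule bd[OF that])
      show "((\<lambda>u. W i u powr r) has_real_derivative r * W i u powr (r - 1) * W' i u) (at u)"
        if "i \<in> I" "u \<in> J" for i u
      proof -
        have "0 < W i u" using pos[OF that] by simp
        thus ?thesis using W'(1) that by (intro DERIV_chain2[OF has_real_derivative_powr]) auto
      qed
      show "uniform_derivs k I J (\<lambda>i u. r * W i u powr (r - 1) * W' i u)"
        by (intro uniform_derivs_mult uniform_derivs_const[where C = "\<bar>r\<bar>"] Suc.IH W'(2)) auto
    qed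
  }
qed

section \<open>Finite differences\<close>

text \<open>
  The \<open>m\<close>-th difference of \<open>f\<close> with step \<open>h\<close>, normalised so that the value at \<open>x\<close> itself has the
  coefficient 1.
\<close>

primrec alt_diff :: "nat \<Rightarrow> real \<Rightarrow> (real \<Rightarrow> real) \<Rightarrow> real \<Rightarrow> real" where
  "alt_diff 0 h f x = f x"
| "alt_diff (Suc m) h f x = alt_diff m h f x - alt_diff m h f (x + h)"

lemma alt_diff_sum:
  "alt_diff m h f x = (\<Sum>j\<le>m. (- 1) ^ j * real (m choose j) * f (x + real j * h))"
proof (induction m arbitrary: x)
  case (Suc m)
  have "(\<Sum>j\<le>Suc m. (- 1) ^ j * real (Suc m choose j) * f (x + real j * h)) =
     f x + (\<Sum>j\<le>m. (- 1) ^ Suc j * real (Suc m choose Suc j) * f (x + real (Suc j) * h))"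
    by (subst sum.atMost_Suc_shift) simp
  also have "(\<Sum>j\<le>m. (- 1) ^ Suc j * real (Suc m choose Suc j) * f (x + real (Suc j) * h)) =
     (\<Sum>j\<le>m. (- 1) ^ Suc j * real (m choose Suc j) * f (x + real (Suc j) * h)) -
     (\<Sum>j\<le>m. (- 1) ^ j * real (m choose j) * f (x + h + real j * h))"
    unfolding sum_subtractf[symmetric] by (rule sum.cong) (simp_all add: algebra_simps)
  also have "f x + ((\<Sum>j\<le>m. (- 1) ^ Suc j * real (m choose Suc j) * f (x + real (Suc j) * h)) -
     (\<Sum>j\<le>m. (- 1) ^ j * real (m choose j) * f (x + h + real j * h))) =
     (\<Sum>j\<le>Suc m. (- 1) ^ j * real (m choose j) * f (x + real j * h)) -
     (\<Sum>j\<le>m. (- 1) ^ j * real (m choose j) * f (x + h + real j * h))"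
    by (subst sum.atMost_Suc_shift) simp
  finally show ?case using Suc by simp
qed simp

lemma alt_diff_bound:
  assumes "uniform_derivs m I {0..b} f"
  shows "\<exists>C. \<forall>i\<in>I. \<forall>h\<ge>0. \<forall>x\<ge>0. x + real m * h \<le> b \<longrightarrow> \<bar>alt_diff m h (f i) x\<bar> \<le> C * h ^ m"
  using assms
proof (induction m arbitrary: f)
  case 0
  then obtain C where "\<forall>i\<in>I. \<forall>u\<in>{0..b}. \<bar>f i u\<bar> \<le> C" by auto
  thus ?case by (intro exI[of _ C]) auto
next
  case (Suc m)
  then obtain f' where der: "\<forall>i\<in>I. \<forall>u\<in>{0..b}. (f i has_real_derivative f' i u) (at u)"
    and "uniform_derivs m I {0..b} f'"
    unfolding uniform_derivs.simps by blast
  note f' = der[rule_format, OF _ atLeastAtMost_iff[THEN iffD2], OF _ conjI]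
  obtain C where C: "\<And>i h x. i \<in> I \<Longrightarrow> h \<ge> 0 \<Longrightarrow> x \<ge> 0 \<Longrightarrow> x + real m * h \<le> b \<Longrightarrow>
      \<bar>alt_diff m h (f' i) x\<bar> \<le> C * h ^ m"
    using Suc.IH[OF \<open>uniform_derivs m I {0..b} f'\<close>] by blast
  have "\<bar>alt_diff (Suc m) h (f i) x\<bar> \<le> C * h ^ Suc m"
    if i: "i \<in> I" and h: "h \<ge> 0" and x: "x \<ge> 0" and b: "x + real (Suc m) * h \<le> b" for i h x
  proof (cases "h = 0")
    case False
    hence hp: "x < x + h" using h by simp
    have D: "(alt_diff m h (f i) has_real_derivative alt_diff m h (f' i) y) (at y)"
      if y: "x \<le> y" "y \<le> x + h" for y
    proof -
      have "(f i has_real_derivative f' i (y + real j * h)) (at (y + real j * h))" if "j \<le> m" for j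
      proof (rule f'[OF i])
        have "real j * h \<le> real m * h" using that h by (intro mult_right_mono) auto
        thus "y + real j * h \<le> b" using y b by (simp add: algebra_simps)
      qed (use x y h in auto)
      hence "((\<lambda>y. f i (y + real j * h)) has_real_derivative f' i (y + real j * h)) (at y)" if "j \<le> m" for j
        using that by (simp add: DERIV_shift)
      thus ?thesis unfolding alt_diff_sum[abs_def]
        by (auto intro!: DERIV_sum DERIV_cmult)
    qed
    obtain z where z: "x < z" "z < x + h"
      and eq: "alt_diff m h (f i) (x + h) - alt_diff m h (f i) x = (x + h - x) * alt_diff m h (f' i) z"
      using MVT2[OF hp D] by blast
    have "\<bar>alt_diff (Suc m) h (f i) x\<bar> = h * \<bar>alt_diff m h (f' i) z\<bar>"
      using eq h by (simp add: abs_minus_commute[of "alt_diff m h (f i) x"] abs_mult)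
    also have "\<dots> \<le> h * (C * h ^ m)"
      using z x b h i by (intro mult_left_mono C) (auto simp: algebra_simps)
    finally show ?thesis by (simp add: algebra_simps)
  qed simp
  thus ?case by blast
qed

section \<open>Decay of the alternating sum\<close>

text \<open>
  For unit vectors \<open>x\<close> and \<open>\<eta>\<close> with \<open>t = x \<bullet> \<eta>\<close>, and for \<open>d \<ge> 2\<close> and \<open>s > 0\<close>, the radial profile at \<open>s\<close>
  is the Poisson kernel with the pole \<open>(1 + s) \<eta>\<close>, multiplied by \<open>(1 + s)\<^bsup>d-1\<^esup>\<close> and by the area of the
  sphere.
\<close>

definition radial_profile :: "nat \<Rightarrow> real \<Rightarrow> real \<Rightarrow> real" where
  "radial_profile d t s = (1 + s) ^ (d - 2) * (s * (2 + s)) / sqrt (2 * (1 - t) * (1 + s) + s\<^sup>2) ^ d"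

text \<open>
  The radial profile in the variable \<open>u = s / \<delta>\<close>, where \<open>\<delta> = sqrt (2 (1 - t))\<close> is the chord length
  \<open>|x - \<eta>|\<close>, with the factor \<open>\<delta>\<^bsup>-(d-1)\<^esup>\<close> removed. It remains smooth as \<open>\<delta>\<close> tends to 0.
\<close>

definition scaled_profile :: "nat \<Rightarrow> real \<Rightarrow> real \<Rightarrow> real" where
  "scaled_profile d \<delta> u =
     (1 + \<delta> * u) ^ (d - 2) * (u * (2 + \<delta> * u)) * ((1 + \<delta> * u + u\<^sup>2) powr (- (1 / 2))) ^ d"

lemma radial_profile_scaled:
  assumes d: "d \<ge> 1" and \<delta>: "\<delta> > 0" "\<delta>\<^sup>2 = 2 * (1 - t)" and u: "u \<ge> 0"
  shows "radial_profile d t (\<delta> * u) = scaled_profile d \<delta> u / \<delta> ^ (d - 1)"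
proof -
  have "0 < 1 + \<delta> * u + u\<^sup>2" using \<delta> u by (simp add: add_pos_nonneg)
  hence p: "(1 + \<delta> * u + u\<^sup>2) powr (- (1 / 2)) = 1 / sqrt (1 + \<delta> * u + u\<^sup>2)"
    by (simp add: powr_minus powr_half_sqrt inverse_eq_divide)
  have "2 * (1 - t) * (1 + \<delta> * u) + (\<delta> * u)\<^sup>2 = \<delta>\<^sup>2 * (1 + \<delta> * u + u\<^sup>2)"
    unfolding \<delta>(2)[symmetric] by (simp add: power2_eq_square algebra_simps)
  hence s: "sqrt (2 * (1 - t) * (1 + \<delta> * u) + (\<delta> * u)\<^sup>2) = \<delta> * sqrt (1 + \<delta> * u + u\<^sup>2)"
    using \<delta>(1) by (simp only: real_sqrt_mult real_sqrt_abs abs_of_pos)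
  have "\<delta> ^ d = \<delta> * \<delta> ^ (d - 1)" using d by (cases d) auto
  thus ?thesis unfolding radial_profile_def scaled_profile_def s p
    using \<delta> by (simp add: power_mult_distrib power_divide)
qed

lemma uniform_derivs_scaled_profile:
  "uniform_derivs k {0..2} {0..b} (scaled_profile d)"
proof -
  have W: "uniform_derivs k {0..2} {0..b} (\<lambda>\<delta> u. 1 + \<delta> * u + u\<^sup>2)" for k
    by (intro uniform_derivs_add uniform_derivs_mult uniform_derivs_power
        uniform_derivs_const[where C = 2] uniform_derivs_ident[where C = b]) auto
  have "uniform_derivs k {0..2} {0..b} (\<lambda>\<delta> u. (1 + \<delta> * u + u\<^sup>2) powr (- (1 / 2)))"
    by (rule uniform_derivs_powr[OF W]) auto
  thus ?thesis unfolding scaled_profile_def[abs_def]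
    by (intro uniform_derivs_add uniform_derivs_mult uniform_derivs_power
        uniform_derivs_const[where C = 2] uniform_derivs_ident[where C = b]) auto
qed

lemma arccos_le_chord:
  assumes "-1 \<le> t" "t \<le> 1"
  shows "arccos t \<le> 4 * sqrt (2 * (1 - t))"
proof -
  define x where "x = arccos t / 2"
  have x: "0 \<le> x" "x \<le> pi / 2" using arccos_bounded[OF assms] by (auto simp: x_def)
  have x2: "x \<le> 2" using x pi_half_less_two by linarith
  \<comment> \<open>The third order Taylor bound suffices, as \<open>x\<^sup>2 \<le> 4\<close> gives \<open>x - x\<^sup>3 / 6 \<ge> x / 3\<close>.\<close>
  have "\<bar>sin x - (\<Sum>m<3. sin_coeff m * x ^ m)\<bar> \<le> inverse (fact 3) * \<bar>x\<bar> ^ 3"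
    by (rule Maclaurin_sin_bound)
  moreover have "(\<Sum>m<3. sin_coeff m * x ^ m) = x"
    by (simp add: sin_coeff_def numeral_3_eq_3 lessThan_Suc)
  ultimately have "\<bar>sin x - x\<bar> \<le> x ^ 3 / 6" using x by (simp add: fact_numeral field_simps)
  hence "x - x ^ 3 / 6 \<le> sin x" by (simp only: abs_le_iff) linarith
  moreover have "x ^ 3 \<le> 4 * x"
  proof -
    have "x * x\<^sup>2 \<le> x * 2\<^sup>2" using x x2 by (intro mult_left_mono power_mono) auto
    thus ?thesis by (simp add: power3_eq_cube power2_eq_square)
  qed
  ultimately have "x \<le> 4 * sin x" using x by linarith
  moreover have "2 * (1 - t) = (2 * sin x)\<^sup>2"
    using cos_double_sin[of x] assms by (simp add: x_def cos_arccos power_mult_distrib)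
  moreover have "sin x \<ge> 0" using x by (intro sin_ge_zero) auto
  ultimately have "sqrt (2 * (1 - t)) = 2 * sin x" by (simp only: real_sqrt_abs)
  thus ?thesis using \<open>x \<le> 4 * sin x\<close> by (simp add: x_def)
qed

lemma radial_profile_bound:
  assumes s: "0 < s" and t: "t \<le> 1" and d: "d \<ge> 1"
  shows "\<bar>radial_profile d t s\<bar> \<le> (1 + s) ^ (d - 2) * (2 + s) / s ^ (d - 1)"
proof -
  have "s \<le> sqrt (2 * (1 - t) * (1 + s) + s\<^sup>2)"
    using s t by (intro real_le_rsqrt) simp
  hence "s ^ d \<le> sqrt (2 * (1 - t) * (1 + s) + s\<^sup>2) ^ d" using s by (intro power_mono) auto
  hence "radial_profile d t s \<le> (1 + s) ^ (d - 2) * (s * (2 + s)) / s ^ d"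
    unfolding radial_profile_def
    using s zero_less_power[OF s, of d] by (intro divide_left_mono mult_pos_pos) (auto simp del: zero_less_power)
  also have "s ^ d = s * s ^ (d - 1)" using d by (cases d) auto
  finally have "radial_profile d t s \<le> (1 + s) ^ (d - 2) * (2 + s) / s ^ (d - 1)" using s by simp
  moreover have "radial_profile d t s \<ge> 0" unfolding radial_profile_def using s t by auto
  ultimately show ?thesis by simp
qed

text \<open>
  If \<open>\<epsilon> \<le> \<delta>\<close>, the sum is up to sign and the factor \<open>\<delta>\<^bsup>-(d-1)\<^esup>\<close> an \<open>m\<close>-th difference with step \<open>\<epsilon> / \<delta>\<close> of
  the scaled profile, which vanishes at 0; this gives the bound \<open>C \<delta>\<^bsup>-(d-1)\<^esup> (\<epsilon> / \<delta>)\<^sup>m\<close>. If \<open>\<delta> < \<epsilon>\<close>, no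
  cancellation is needed, as each term is \<open>O(\<epsilon>\<^bsup>-(d-1)\<^esup>)\<close>.
\<close>

proposition alternating_profile_sum_bound:
  assumes d: "d \<ge> 1"
  shows "\<exists>c>0. \<forall>\<epsilon> t. 0 < \<epsilon> \<and> \<epsilon> \<le> 1 \<and> -1 \<le> t \<and> t \<le> 1 \<longrightarrow>
    \<bar>\<Sum>j=1..m. (- 1) ^ (j + 1) * real (m choose j) * radial_profile d t (real j * \<epsilon>)\<bar>
      \<le> c / \<epsilon> ^ (d - 1) / (1 + arccos t / \<epsilon>) ^ (m + d - 1)"
proof -
  define N where "N = m + d - 1"
  obtain C where C: "\<And>\<delta> h. 0 \<le> \<delta> \<Longrightarrow> \<delta> \<le> 2 \<Longrightarrow> 0 \<le> h \<Longrightarrow> h \<le> 1 \<Longrightarrow>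
      \<bar>alt_diff m h (scaled_profile d \<delta>) 0\<bar> \<le> C * h ^ m"
  proof -
    obtain C where C: "\<forall>\<delta>\<in>{0..2}. \<forall>h\<ge>0. \<forall>x\<ge>0. x + real m * h \<le> real m \<longrightarrow>
        \<bar>alt_diff m h (scaled_profile d \<delta>) x\<bar> \<le> C * h ^ m"
      using alt_diff_bound[OF uniform_derivs_scaled_profile[of m "real m" d]] by blast
    show ?thesis by (rule that[of C]) (use C in \<open>auto simp: mult_left_le\<close>)
  qed
  define K where "K = 2 ^ m * (real (m + 1) ^ (d - 2) * real (m + 2))"
  \<comment> \<open>The base 5 is \<open>1 + 4\<close>: the angle is at most 4 times the chord length.\<close>
  define c where "c = (\<bar>C\<bar> + K) * 5 ^ N"
  have K: "K > 0" by (simp add: K_def)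
  have "\<bar>\<Sum>j=1..m. (- 1) ^ (j + 1) * real (m choose j) * radial_profile d t (real j * \<epsilon>)\<bar>
      \<le> c / \<epsilon> ^ (d - 1) / (1 + arccos t / \<epsilon>) ^ N" (is "\<bar>?S\<bar> \<le> _")
    if \<epsilon>: "0 < \<epsilon>" "\<epsilon> \<le> 1" and t: "-1 \<le> t" "t \<le> 1" for \<epsilon> t
  proof -
    define \<delta> where "\<delta> = sqrt (2 * (1 - t))"
    have \<delta>2: "\<delta>\<^sup>2 = 2 * (1 - t)" and \<delta>0: "\<delta> \<ge> 0" using t by (auto simp: \<delta>_def)
    have \<delta>le: "\<delta> \<le> 2" using t by (auto simp: \<delta>_def intro!: real_le_lsqrt)
    define r where "r = 1 + arccos t / \<epsilon>"
    have r1: "r \<ge> 1" using arccos_lbound[OF t] \<epsilon> by (simp add: r_def)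
    have "r \<le> 1 + 4 * \<delta> / \<epsilon>"
      unfolding r_def using arccos_le_chord[OF t] \<epsilon> by (simp add: \<delta>_def divide_right_mono)
    show ?thesis
    proof (cases "\<epsilon> \<le> \<delta>")
      case True
      hence \<delta>: "\<delta> > 0" using \<epsilon> by simp
      define h where "h = \<epsilon> / \<delta>"
      have h: "0 \<le> h" "h \<le> 1" using \<epsilon> \<delta> True by (auto simp: h_def)
      have prof: "radial_profile d t (real j * \<epsilon>) = scaled_profile d \<delta> (real j * h) / \<delta> ^ (d - 1)" for j
      proof -
        have "\<delta> * (real j * h) = real j * \<epsilon>" using \<delta> by (simp add: h_def)
        thus ?thesis using radial_profile_scaled[OF d \<delta> \<delta>2, of "real j * h"] h by (metis mult_nonneg_nonneg of_nat_0_le_iff)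
      qed
      have "?S = (\<Sum>j=1..m. - ((- 1) ^ j * real (m choose j) * scaled_profile d \<delta> (0 + real j * h))) / \<delta> ^ (d - 1)"
        unfolding prof sum_divide_distrib by (intro sum.cong) auto
      \<comment> \<open>The term \<open>j = 0\<close> may be added because the scaled profile vanishes at 0.\<close>
      also have "(\<Sum>j=1..m. - ((- 1) ^ j * real (m choose j) * scaled_profile d \<delta> (0 + real j * h))) =
          (\<Sum>j\<in>{..m}. - ((- 1) ^ j * real (m choose j) * scaled_profile d \<delta> (0 + real j * h)))"
        by (rule sum.mono_neutral_left) (auto simp: scaled_profile_def not_le)
      also have "\<dots> = - alt_diff m h (scaled_profile d \<delta>) 0"
        by (simp add: alt_diff_sum sum_negf)
      finally have "\<bar>?S\<bar> = \<bar>alt_diff m h (scaled_profile d \<delta>) 0\<bar> / \<delta> ^ (d - 1)"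
        using \<delta> by (simp add: abs_divide)
      also have "\<dots> \<le> (\<bar>C\<bar> * h ^ m) / \<delta> ^ (d - 1)"
        using \<delta> \<delta>le h
        by (intro divide_right_mono order.trans[OF C] mult_right_mono) auto
      also have "\<dots> = \<bar>C\<bar> / \<epsilon> ^ (d - 1) * h ^ N"
      proof -
        have "N = m + (d - 1)" using d by (simp add: N_def)
        hence "h ^ N = h ^ m * (\<epsilon> ^ (d - 1) / \<delta> ^ (d - 1))" by (simp add: power_add h_def power_divide)
        thus ?thesis using \<epsilon> by simp
      qed
      also have "\<dots> \<le> \<bar>C\<bar> / \<epsilon> ^ (d - 1) * (5 / r) ^ N"
      proof -
        have "r \<le> 5 * \<delta> / \<epsilon>" using \<open>r \<le> 1 + 4 * \<delta> / \<epsilon>\<close> True \<epsilon> by (simp add: field_simps)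
        hence "h \<le> 5 / r" using r1 \<epsilon> \<delta> by (simp add: h_def field_simps)
        thus ?thesis using \<epsilon> h by (intro mult_left_mono power_mono) auto
      qed
      also have "\<dots> \<le> (\<bar>C\<bar> + K) / \<epsilon> ^ (d - 1) * (5 / r) ^ N"
        using \<epsilon> K r1 by (intro mult_right_mono divide_right_mono) auto
      finally show ?thesis by (simp add: c_def r_def power_divide)
    next
      case False
      have "\<bar>?S\<bar> \<le> (\<Sum>j=1..m. real (m choose j) * ((real (m + 1) ^ (d - 2) * real (m + 2)) / \<epsilon> ^ (d - 1)))"
      proof (rule order.trans[OF sum_abs], rule sum_mono)
        fix j assume j: "j \<in> {1..m}"
        have j\<epsilon>: "\<epsilon> \<le> real j * \<epsilon>" "real j * \<epsilon> \<le> real m"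
          using j \<epsilon> mult_mono[of "real j" "real m" \<epsilon> 1] by auto
        have "\<bar>radial_profile d t (real j * \<epsilon>)\<bar> \<le>
            (1 + real j * \<epsilon>) ^ (d - 2) * (2 + real j * \<epsilon>) / (real j * \<epsilon>) ^ (d - 1)"
          using j \<epsilon> t d by (intro radial_profile_bound) auto
        also have "\<dots> \<le> (real (m + 1) ^ (d - 2) * real (m + 2)) / \<epsilon> ^ (d - 1)"
          using j\<epsilon> \<epsilon> by (intro frac_le mult_mono power_mono) auto
        finally show "\<bar>(- 1) ^ (j + 1) * real (m choose j) * radial_profile d t (real j * \<epsilon>)\<bar> \<le>
            real (m choose j) * ((real (m + 1) ^ (d - 2) * real (m + 2)) / \<epsilon> ^ (d - 1))"
          unfolding abs_mult by (simp add: mult_left_mono del: times_divide_eq_right)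
      qed
      also have "\<dots> = real (\<Sum>j=1..m. m choose j) * ((real (m + 1) ^ (d - 2) * real (m + 2)) / \<epsilon> ^ (d - 1))"
        unfolding of_nat_sum sum_distrib_right ..
      also have "\<dots> \<le> 2 ^ m * ((real (m + 1) ^ (d - 2) * real (m + 2)) / \<epsilon> ^ (d - 1))"
      proof (rule mult_right_mono)
        have "(\<Sum>j=1..m. m choose j) \<le> (\<Sum>j\<le>m. m choose j)" by (rule sum_mono2) auto
        also have "\<dots> = 2 ^ m" by (rule choose_row_sum)
        finally show "real (\<Sum>j=1..m. m choose j) \<le> 2 ^ m" by (metis of_nat_le_iff of_nat_numeral of_nat_power)
      qed (use \<epsilon> in auto)
      also have "\<dots> = K / \<epsilon> ^ (d - 1)" by (simp add: K_def)
      also have "\<dots> \<le> (\<bar>C\<bar> + K) / \<epsilon> ^ (d - 1) * (5 / r) ^ N"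
      proof -
        have "4 * \<delta> / \<epsilon> \<le> 4" using False \<epsilon> by (simp add: field_simps)
        hence "1 \<le> 5 / r" using \<open>r \<le> 1 + 4 * \<delta> / \<epsilon>\<close> r1 by simp
        hence "1 \<le> (5 / r) ^ N" by (rule one_le_power)
        hence "(\<bar>C\<bar> + K) / \<epsilon> ^ (d - 1) * 1 \<le> (\<bar>C\<bar> + K) / \<epsilon> ^ (d - 1) * (5 / r) ^ N"
          using \<epsilon> K by (intro mult_left_mono) auto
        moreover have "K / \<epsilon> ^ (d - 1) \<le> (\<bar>C\<bar> + K) / \<epsilon> ^ (d - 1)"
          using \<epsilon> by (intro divide_right_mono) auto
        ultimately show ?thesis by simp
      qed
      finally show ?thesis by (simp add: c_def r_def power_divide)
    qed
  qed
  moreover have "c > 0" using K by (simp add: c_def add_nonneg_pos)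
  ultimately show ?thesis unfolding N_def by blast
qed

section \<open>The Poisson kernel on the sphere\<close>

lemma norm_sphere_point_diff:
  fixes x \<eta> :: "'a::real_inner"
  assumes "norm x = 1" "norm \<eta> = 1"
  shows "norm (x - (1 + s) *\<^sub>R \<eta>) = sqrt (2 * (1 - x \<bullet> \<eta>) * (1 + s) + s\<^sup>2)"
proof -
  have "x \<bullet> x = 1" "\<eta> \<bullet> \<eta> = 1" using assms by (simp_all add: norm_eq_1)
  hence "(x - (1 + s) *\<^sub>R \<eta>) \<bullet> (x - (1 + s) *\<^sub>R \<eta>) = 2 * (1 - x \<bullet> \<eta>) * (1 + s) + s\<^sup>2"
    by (simp add: inner_diff inner_commute power2_eq_square algebra_simps)
  thus ?thesis by (simp add: norm_eq_sqrt_inner)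
qed

lemma poisson_kernel_on_sphere:
  fixes x \<eta> :: "real ^ 'n"
  assumes "CARD('n) \<ge> 2" "norm x = 1" "norm \<eta> = 1" "s > 0"
  shows "(1 + s) ^ (CARD('n) - 1) * poisson_kernel ((1 + s) *\<^sub>R \<eta>) x =
    radial_profile CARD('n) (x \<bullet> \<eta>) s / sphere_area CARD('n)"
proof -
  have "(1 + s) ^ (CARD('n) - 1) = (1 + s) * (1 + s) ^ (CARD('n) - 2)"
    using assms(1) by (metis Suc_diff_le Suc_1 diff_Suc_Suc power_Suc One_nat_def)
  moreover have "(1 + s)\<^sup>2 - 1 = s * (2 + s)" by (simp add: power2_eq_square algebra_simps)
  ultimately show ?thesis
    using assms by (simp add: poisson_kernel_def radial_profile_def norm_sphere_point_diff)
qed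

lemma poisson_kernel_sphere_integral:
  fixes \<eta> :: "real ^ 'n"
  assumes "CARD('n) \<ge> 2" "norm \<eta> = 1" "a > 1"
  shows "has_bochner_integral sphere_measure (\<lambda>x. a ^ (CARD('n) - 1) * poisson_kernel (a *\<^sub>R \<eta>) x) 1"
proof -
  \<comment> \<open>The point \<open>p\<close> is the inversion of the pole \<open>a \<eta>\<close> in the unit sphere; on the sphere the
    distances to the two points differ by the factor \<open>a\<close>.\<close>
  define p where "p = (1 / a) *\<^sub>R \<eta>"
  have p: "norm p = 1 / a" using assms by (simp add: p_def)
  have area: "sphere_area CARD('n) > 0" by (simp add: sphere_area_def Gamma_real_pos)
  have "has_bochner_integral sphere_measure
      (\<lambda>x. (1 - (norm p)\<^sup>2) / norm (x - p) ^ CARD('n) / sphere_area CARD('n))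
      (sphere_area CARD('n) / sphere_area CARD('n))"
    by (intro has_bochner_integral_divide_zero poisson_sphere_integral) (use p assms in simp)
  moreover have "(1 - (norm p)\<^sup>2) / norm (x - p) ^ CARD('n) / sphere_area CARD('n) =
      a ^ (CARD('n) - 1) * poisson_kernel (a *\<^sub>R \<eta>) x" if x: "norm x = 1" for x
  proof -
    have "(norm (x - a *\<^sub>R \<eta>))\<^sup>2 = (a * norm (x - p))\<^sup>2"
      using x assms(2,3) unfolding power_mult_distrib
      by (simp add: p_def power2_norm_eq_inner inner_diff inner_commute norm_eq_1)
         (simp add: field_simps power2_eq_square)
    hence n: "norm (x - a *\<^sub>R \<eta>) = a * norm (x - p)"
      using assms(3) by (subst (asm) power2_eq_iff_nonneg) auto
    have "a ^ CARD('n) = a * a * a ^ (CARD('n) - 2)" "a ^ (CARD('n) - 1) = a * a ^ (CARD('n) - 2)"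
      using assms(1) by (metis le_add_diff_inverse power_add power2_eq_square,
        metis Suc_diff_le Suc_1 diff_Suc_Suc power_Suc One_nat_def)
    moreover have "norm (x - p) > 0" using x p assms(3) by auto
    ultimately show ?thesis using x assms(2,3) area
      by (simp add: poisson_kernel_def n p power_mult_distrib) (simp add: field_simps power2_eq_square)
  qed
  ultimately show ?thesis
    using area by (subst has_bochner_integral_cong[OF refl _ refl]) (auto simp: space_sphere_measure)
qed

lemma alternating_binomial_sum_from_1:
  assumes "m \<ge> 1"
  shows "(\<Sum>j=1..m. (- 1) ^ (j + 1) * real (m choose j)) = 1"
proof -
  have "0 = (\<Sum>j\<le>m. (- 1) ^ j * real (m choose j))"
    using choose_alternating_sum[of m, where 'a = real] assms by simp
  also have "{..m} = insert 0 {1..m}" by auto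
  finally show ?thesis by (simp add: sum_negf)
qed

lemma poisson_comb_sphere_integral:
  fixes \<eta> :: "real ^ 'n"
  assumes "m \<ge> 1" "CARD('n) \<ge> 2" "norm \<eta> = 1" "\<epsilon> > 0"
  shows "(LINT x|sphere_measure. poisson_comb m \<epsilon> \<eta> x) = 1"
proof -
  have "has_bochner_integral sphere_measure
      (\<lambda>x. \<Sum>j=1..m. (- 1) ^ (j + 1) * real (m choose j) *
        ((1 + real j * \<epsilon>) ^ (CARD('n) - 1) * poisson_kernel ((1 + real j * \<epsilon>) *\<^sub>R \<eta>) x))
      (\<Sum>j=1..m. (- 1) ^ (j + 1) * real (m choose j) * 1)"
    by (intro has_bochner_integral_sum has_bochner_integral_mult_right poisson_kernel_sphere_integral)
       (use assms in auto)
  thus ?thesis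
    using alternating_binomial_sum_from_1[OF assms(1)]
    by (simp add: has_bochner_integral_iff poisson_comb_def mult.assoc)
qed

section \<open>Decomposition into fundamental solutions\<close>

lemma norm_line_derivative:
  fixes x y v :: "'a::real_inner"
  assumes "x \<noteq> y"
  shows "((\<lambda>t. norm (x + t *\<^sub>R v - y)) has_real_derivative ((x - y) \<bullet> v / norm (x - y))) (at 0)"
proof -
  have 1: "((\<lambda>t. x + t *\<^sub>R v - y) has_derivative (\<lambda>t. t *\<^sub>R v)) (at 0)"
    by (auto intro!: derivative_eq_intros)
  have "(norm has_derivative (\<lambda>h. h \<bullet> sgn (x - y))) (at (x + 0 *\<^sub>R v - y))"
    using has_derivative_norm[of "x - y"] assms by simp
  from has_derivative_compose[OF 1 this] show ?thesis
    by (simp add: has_field_derivative_def sgn_div_norm divide_inverse inner_commute mult.commute mult.left_commute mult_commute_abs)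
qed

lemma dir_deriv_inverse_norm_power:
  fixes x y v :: "real ^ 'n"
  assumes "x \<noteq> y"
  shows "dir_deriv v (\<lambda>z. 1 / norm (z - y) ^ k) x = - (real k * ((x - y) \<bullet> v) / norm (x - y) ^ (k + 2))"
proof -
  define r where "r = norm (x - y)"
  have r: "r > 0" using assms by (simp add: r_def)
  have "((\<lambda>t. inverse (norm (x + t *\<^sub>R v - y) ^ k)) has_real_derivative
      - (real k * ((x - y) \<bullet> v / r * r ^ (k - Suc 0)) * inverse ((r ^ k) ^ Suc (Suc 0)))) (at 0)"
    using DERIV_inverse_fun[OF DERIV_power[OF norm_line_derivative[OF assms, of v], of k]] assms
    by (simp add: r_def)
  also have "real k * ((x - y) \<bullet> v / r * r ^ (k - Suc 0)) * inverse ((r ^ k) ^ Suc (Suc 0)) =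
      real k * ((x - y) \<bullet> v) / r ^ (k + 2)"
    using r by (cases k) (simp_all add: divide_simps power_add power2_eq_square)
  finally show ?thesis unfolding dir_deriv_def inverse_eq_divide r_def by (rule DERIV_imp_deriv)
qed

lemma dir_deriv_ln_inverse_norm:
  fixes x y v :: "real ^ 'n"
  assumes "x \<noteq> y"
  shows "dir_deriv v (\<lambda>z. ln (1 / norm (z - y))) x = - ((x - y) \<bullet> v / (norm (x - y))\<^sup>2)"
proof -
  have "((\<lambda>t. - ln (norm (x + t *\<^sub>R v - y))) has_real_derivative
      - (inverse (norm (x - y)) * ((x - y) \<bullet> v / norm (x - y)))) (at 0)"
    by (intro DERIV_minus DERIV_chain2[OF DERIV_ln norm_line_derivative[OF assms]]
          DERIV_chain2[where g = "\<lambda>t. norm (x + t *\<^sub>R v - y)", OF _ norm_line_derivative[OF assms]])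
       (use assms DERIV_ln[of "norm (x - y)"] in simp)
  also have "(\<lambda>t. - ln (norm (x + t *\<^sub>R v - y))) = (\<lambda>t. ln (1 / norm (x + t *\<^sub>R v - y)))"
    by (simp add: ln_div fun_eq_iff)
  also have "inverse (norm (x - y)) * ((x - y) \<bullet> v / norm (x - y)) = (x - y) \<bullet> v / (norm (x - y))\<^sup>2"
    by (simp add: divide_inverse power2_eq_square)
  finally show ?thesis unfolding dir_deriv_def by (rule DERIV_imp_deriv)
qed

text \<open>
  With \<open>z = x - a \<eta>\<close> the numerator \<open>a\<^sup>2 - |x|\<^sup>2\<close> of the kernel equals \<open>- |z|\<^sup>2 - 2 a (z \<bullet> \<eta>)\<close>.
\<close>

lemma poisson_kernel_decomposition:
  fixes x \<eta> :: "real ^ 'n"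
  assumes d: "CARD('n) \<ge> 2" and "norm \<eta> = 1" "a > 0" "x \<noteq> a *\<^sub>R \<eta>"
  shows "poisson_kernel (a *\<^sub>R \<eta>) x =
    - (1 / (a * sphere_area CARD('n))) * (1 / norm (x - a *\<^sub>R \<eta>) ^ (CARD('n) - 2))
    - (2 / sphere_area CARD('n)) * ((x - a *\<^sub>R \<eta>) \<bullet> \<eta> / norm (x - a *\<^sub>R \<eta>) ^ CARD('n))"
proof -
  define z where "z = x - a *\<^sub>R \<eta>"
  have z: "norm z > 0" using assms by (simp add: z_def)
  have x: "x = z + a *\<^sub>R \<eta>" by (simp add: z_def)
  have "(norm x)\<^sup>2 = (norm z)\<^sup>2 + 2 * a * (z \<bullet> \<eta>) + a\<^sup>2"
    using assms(2) unfolding x power2_norm_eq_inner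
    by (simp add: inner_add inner_commute norm_eq_1) (simp add: power2_eq_square algebra_simps)
  hence num: "a\<^sup>2 - (norm x)\<^sup>2 = - ((norm z)\<^sup>2 + 2 * a * (z \<bullet> \<eta>))" by simp
  have area: "sphere_area CARD('n) > 0" by (simp add: sphere_area_def Gamma_real_pos)
  have "norm z ^ CARD('n) = (norm z)\<^sup>2 * norm z ^ (CARD('n) - 2)"
    using d by (metis le_add_diff_inverse power_add)
  thus ?thesis unfolding poisson_kernel_def z_def[symmetric]
    using assms z area by (simp add: num) (simp add: field_simps)
qed

section \<open>Localised combinations of Poisson kernels\<close>

theorem theorem2p1:
  fixes m :: nat
  assumes "m \<ge> 1" and "CARD('n) \<ge> 2"
  shows "\<exists>c::real. c > 0 \<and>
    (\<forall>\<epsilon>::real. 0 < \<epsilon> \<and> \<epsilon> \<le> 1 \<longrightarrow>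
      (\<exists>F :: real \<Rightarrow> real. \<forall>\<eta> \<in> sphere (0 :: real ^ 'n) 1.
        (\<forall>x \<in> sphere 0 1. poisson_comb m \<epsilon> \<eta> x = F (x \<bullet> \<eta>)) \<and>
        (\<forall>x \<in> sphere 0 1.
           \<bar>F (x \<bullet> \<eta>)\<bar> \<le> c * \<epsilon> powi (- int CARD('n) + 1) /
             (1 + inverse \<epsilon> * sphere_dist x \<eta>) ^ (m + CARD('n) - 1)) \<and>
        (LINT x|sphere_measure. F (x \<bullet> \<eta>)) = 1 \<and>
        (CARD('n) > 2 \<longrightarrow>
          (\<exists>b c' :: nat \<Rightarrow> real. \<forall>x. x \<notin> (\<Union>j\<in>{1..m}. {(1 + real j * \<epsilon>) *\<^sub>R \<eta>}) \<longrightarrow>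
            poisson_comb m \<epsilon> \<eta> x =
              (\<Sum>j = 1..m. b j / norm (x - (1 + real j * \<epsilon>) *\<^sub>R \<eta>) ^ (CARD('n) - 2)) +
              (\<Sum>j = 1..m. c' j * dir_deriv \<eta>
                 (\<lambda>z. 1 / norm (z - (1 + real j * \<epsilon>) *\<^sub>R \<eta>) ^ (CARD('n) - 2)) x))) \<and>
        (CARD('n) = 2 \<longrightarrow>
          (\<exists>(b0 :: real) (c' :: nat \<Rightarrow> real). \<forall>x. x \<notin> (\<Union>j\<in>{1..m}. {(1 + real j * \<epsilon>) *\<^sub>R \<eta>}) \<longrightarrow>
            poisson_comb m \<epsilon> \<eta> x =
              b0 + (\<Sum>j = 1..m. c' j * dir_deriv \<eta>
                 (\<lambda>z. ln (1 / norm (z - (1 + real j * \<epsilon>) *\<^sub>R \<eta>))) x)))))"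
proof -
  define d where "d = CARD('n)"
  define \<omega> where "\<omega> = sphere_area d"
  have d: "d \<ge> 2" using assms by (simp add: d_def)
  have \<omega>: "\<omega> > 0" using d by (simp add: \<omega>_def sphere_area_def Gamma_real_pos)
  obtain c where c: "c > 0" and bound: "\<And>\<epsilon> t. 0 < \<epsilon> \<Longrightarrow> \<epsilon> \<le> 1 \<Longrightarrow> -1 \<le> t \<Longrightarrow> t \<le> 1 \<Longrightarrow>
      \<bar>\<Sum>j=1..m. (- 1) ^ (j + 1) * real (m choose j) * radial_profile d t (real j * \<epsilon>)\<bar>
        \<le> c / \<epsilon> ^ (d - 1) / (1 + arccos t / \<epsilon>) ^ (m + d - 1)"
    using alternating_profile_sum_bound[of d m] d by auto
  show ?thesis
  proof (rule exI[of _ "c / \<omega>"], intro conjI allI impI, use c \<omega> in simp, elim conjE)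
    fix \<epsilon> :: real assume \<epsilon>: "0 < \<epsilon>" "\<epsilon> \<le> 1"
    define a where "a = (\<lambda>j. 1 + real j * \<epsilon>)"
    define w where "w = (\<lambda>j. (- 1) ^ (j + 1) * real (m choose j))"
    define F where "F = (\<lambda>t. (\<Sum>j=1..m. w j * radial_profile d t (real j * \<epsilon>)) / \<omega>)"
    have a_eq: "1 + real j * \<epsilon> = a j" for j by (simp add: a_def)
    have a: "a j > 0" for j using \<epsilon> by (simp add: a_def add_pos_nonneg)
    show "\<exists>F :: real \<Rightarrow> real. \<forall>\<eta> \<in> sphere (0 :: real ^ 'n) 1.
        (\<forall>x \<in> sphere 0 1. poisson_comb m \<epsilon> \<eta> x = F (x \<bullet> \<eta>)) \<and>
        (\<forall>x \<in> sphere 0 1.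
           \<bar>F (x \<bullet> \<eta>)\<bar> \<le> c / \<omega> * \<epsilon> powi (- int CARD('n) + 1) /
             (1 + inverse \<epsilon> * sphere_dist x \<eta>) ^ (m + CARD('n) - 1)) \<and>
        (LINT x|sphere_measure. F (x \<bullet> \<eta>)) = 1 \<and>
        (CARD('n) > 2 \<longrightarrow>
          (\<exists>b c' :: nat \<Rightarrow> real. \<forall>x. x \<notin> (\<Union>j\<in>{1..m}. {(1 + real j * \<epsilon>) *\<^sub>R \<eta>}) \<longrightarrow>
            poisson_comb m \<epsilon> \<eta> x =
              (\<Sum>j = 1..m. b j / norm (x - (1 + real j * \<epsilon>) *\<^sub>R \<eta>) ^ (CARD('n) - 2)) +
              (\<Sum>j = 1..m. c' j * dir_deriv \<eta>
                 (\<lambda>z. 1 / norm (z - (1 + real j * \<epsilon>) *\<^sub>R \<eta>) ^ (CARD('n) - 2)) x))) \<and>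
        (CARD('n) = 2 \<longrightarrow>
          (\<exists>(b0 :: real) (c' :: nat \<Rightarrow> real). \<forall>x. x \<notin> (\<Union>j\<in>{1..m}. {(1 + real j * \<epsilon>) *\<^sub>R \<eta>}) \<longrightarrow>
            poisson_comb m \<epsilon> \<eta> x =
              b0 + (\<Sum>j = 1..m. c' j * dir_deriv \<eta>
                 (\<lambda>z. ln (1 / norm (z - (1 + real j * \<epsilon>) *\<^sub>R \<eta>))) x)))"
    proof (rule exI[of _ F], intro ballI)
      fix \<eta> :: "real ^ 'n" assume "\<eta> \<in> sphere 0 1"
      hence \<eta>: "norm \<eta> = 1" by simp
      have on_sphere: "poisson_comb m \<epsilon> \<eta> x = F (x \<bullet> \<eta>)" if "x \<in> sphere 0 1" for x
        unfolding poisson_comb_def F_def w_def sum_divide_distrib \<omega>_def d_def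
      proof (rule sum.cong[OF refl])
        fix j assume "j \<in> {1..m}"
        hence "real j * \<epsilon> > 0" using \<epsilon> by simp
        from poisson_kernel_on_sphere[OF assms(2) _ \<eta> this, of x] that
        show "(- 1) ^ (j + 1) * real (m choose j) * (1 + real j * \<epsilon>) ^ (CARD('n) - 1) *
            poisson_kernel ((1 + real j * \<epsilon>) *\<^sub>R \<eta>) x =
          (- 1) ^ (j + 1) * real (m choose j) * radial_profile CARD('n) (x \<bullet> \<eta>) (real j * \<epsilon>) /
            sphere_area CARD('n)"
          by (simp add: mult.assoc)
      qed
      have decay: "\<bar>F (x \<bullet> \<eta>)\<bar> \<le> c / \<omega> * \<epsilon> powi (- int CARD('n) + 1) /
          (1 + inverse \<epsilon> * sphere_dist x \<eta>) ^ (m + CARD('n) - 1)" if "x \<in> sphere 0 1" for x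
      proof -
        have "\<bar>x \<bullet> \<eta>\<bar> \<le> 1" using Cauchy_Schwarz_ineq2[of x \<eta>] that \<eta> by simp
        hence t: "-1 \<le> x \<bullet> \<eta>" "x \<bullet> \<eta> \<le> 1" by auto
        have "- int CARD('n) + 1 = - int (d - 1)" using d unfolding d_def by linarith
        hence exponent: "\<epsilon> powi (- int CARD('n) + 1) = 1 / \<epsilon> ^ (d - 1)"
          by (simp only: power_int_minus power_int_of_nat inverse_eq_divide)
        have "\<bar>F (x \<bullet> \<eta>)\<bar> \<le> c / \<epsilon> ^ (d - 1) / (1 + arccos (x \<bullet> \<eta>) / \<epsilon>) ^ (m + d - 1) / \<omega>"
          unfolding F_def w_def abs_divide abs_of_pos[OF \<omega>]
          by (rule divide_right_mono[OF bound[OF \<epsilon> t]]) (use \<omega> in simp)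
        also have "\<dots> = c / \<omega> * \<epsilon> powi (- int CARD('n) + 1) /
            (1 + inverse \<epsilon> * sphere_dist x \<eta>) ^ (m + CARD('n) - 1)"
          unfolding exponent unfolding sphere_dist_def d_def[symmetric] inverse_eq_divide by simp
        finally show ?thesis .
      qed
      have mass: "(LINT x|sphere_measure. F (x \<bullet> \<eta>)) = 1"
      proof -
        have "(LINT x|sphere_measure. F (x \<bullet> \<eta>)) = (LINT x|sphere_measure. poisson_comb m \<epsilon> \<eta> x)"
          by (rule Bochner_Integration.integral_cong) (simp_all add: space_sphere_measure on_sphere)
        thus ?thesis using poisson_comb_sphere_integral[OF assms \<eta> \<epsilon>(1)] by simp
      qed
      \<comment> \<open>Both representations are read off from this one: up to constant factors, its second kernel
        is the directional derivative of the power, or for \<open>d = 2\<close> of the logarithm.\<close>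
      have expand: "poisson_comb m \<epsilon> \<eta> x =
          (\<Sum>j=1..m. w j * a j ^ (d - 1) *
            (- (1 / (a j * \<omega>)) * (1 / norm (x - a j *\<^sub>R \<eta>) ^ (d - 2))
             - (2 / \<omega>) * ((x - a j *\<^sub>R \<eta>) \<bullet> \<eta> / norm (x - a j *\<^sub>R \<eta>) ^ d)))"
        if "\<forall>j\<in>{1..m}. x \<noteq> a j *\<^sub>R \<eta>" for x
        unfolding poisson_comb_def w_def[symmetric] a_def[symmetric] d_def \<omega>_def
        by (rule sum.cong) (use poisson_kernel_decomposition[OF assms(2) \<eta> a bspec[OF that]] in \<open>auto simp: w_def a_def\<close>)
      have rep: "\<exists>b c' :: nat \<Rightarrow> real. \<forall>x. x \<notin> (\<Union>j\<in>{1..m}. {(1 + real j * \<epsilon>) *\<^sub>R \<eta>}) \<longrightarrow>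
            poisson_comb m \<epsilon> \<eta> x =
              (\<Sum>j = 1..m. b j / norm (x - (1 + real j * \<epsilon>) *\<^sub>R \<eta>) ^ (CARD('n) - 2)) +
              (\<Sum>j = 1..m. c' j * dir_deriv \<eta>
                 (\<lambda>z. 1 / norm (z - (1 + real j * \<epsilon>) *\<^sub>R \<eta>) ^ (CARD('n) - 2)) x)"
        if d3: "CARD('n) > 2"
      proof (intro exI allI impI)
        fix x assume "x \<notin> (\<Union>j\<in>{1..m}. {(1 + real j * \<epsilon>) *\<^sub>R \<eta>})"
        hence x: "\<forall>j\<in>{1..m}. x \<noteq> a j *\<^sub>R \<eta>" by (auto simp: a_def)
        have dd: "dir_deriv \<eta> (\<lambda>z. 1 / norm (z - a j *\<^sub>R \<eta>) ^ (d - 2)) x =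
            - (real (d - 2) * ((x - a j *\<^sub>R \<eta>) \<bullet> \<eta>) / norm (x - a j *\<^sub>R \<eta>) ^ d)" if "j \<in> {1..m}" for j
          using dir_deriv_inverse_norm_power[OF bspec[OF x that], of \<eta> "d - 2"] le_add_diff_inverse2[OF d] by (simp only:)
        have d2: "real (d - 2) > 0" using d3 by (simp add: d_def)
        have cancel: "W * (- (1 / A) * (1 / P) - (2 / \<omega>) * (Q / R)) =
            (- (W / A)) / P + (W * 2 / (\<omega> * K)) * (- (K * Q / R))" if "K > 0" for W A P Q R K :: real
        proof -
          have "W * 2 / (\<omega> * K) * (K * Q / R) = W * 2 / \<omega> * (Q / R)" using that by simp
          thus ?thesis by (simp add: right_diff_distrib)
        qed
        show "poisson_comb m \<epsilon> \<eta> x =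
            (\<Sum>j = 1..m. (- (w j * a j ^ (d - 1) / (a j * \<omega>))) / norm (x - (1 + real j * \<epsilon>) *\<^sub>R \<eta>) ^ (CARD('n) - 2)) +
            (\<Sum>j = 1..m. (w j * a j ^ (d - 1) * 2 / (\<omega> * real (d - 2))) * dir_deriv \<eta>
               (\<lambda>z. 1 / norm (z - (1 + real j * \<epsilon>) *\<^sub>R \<eta>) ^ (CARD('n) - 2)) x)"
          unfolding expand[OF x] a_eq d_def[symmetric] sum.distrib[symmetric]
        proof (rule sum.cong[OF refl])
          fix j assume j: "j \<in> {1..m}"
          show "w j * a j ^ (d - 1) *
            (- (1 / (a j * \<omega>)) * (1 / norm (x - a j *\<^sub>R \<eta>) ^ (d - 2))
             - (2 / \<omega>) * ((x - a j *\<^sub>R \<eta>) \<bullet> \<eta> / norm (x - a j *\<^sub>R \<eta>) ^ d)) =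
            (- (w j * a j ^ (d - 1) / (a j * \<omega>))) / norm (x - a j *\<^sub>R \<eta>) ^ (d - 2) +
            (w j * a j ^ (d - 1) * 2 / (\<omega> * real (d - 2))) * dir_deriv \<eta>
               (\<lambda>z. 1 / norm (z - a j *\<^sub>R \<eta>) ^ (d - 2)) x"
            unfolding dd[OF j] by (rule cancel[OF d2])
        qed
      qed
      have rep2: "\<exists>(b0 :: real) (c' :: nat \<Rightarrow> real). \<forall>x. x \<notin> (\<Union>j\<in>{1..m}. {(1 + real j * \<epsilon>) *\<^sub>R \<eta>}) \<longrightarrow>
            poisson_comb m \<epsilon> \<eta> x =
              b0 + (\<Sum>j = 1..m. c' j * dir_deriv \<eta>
                 (\<lambda>z. ln (1 / norm (z - (1 + real j * \<epsilon>) *\<^sub>R \<eta>))) x)"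
        if d2: "CARD('n) = 2"
      proof (intro exI allI impI)
        fix x assume "x \<notin> (\<Union>j\<in>{1..m}. {(1 + real j * \<epsilon>) *\<^sub>R \<eta>})"
        hence x: "\<forall>j\<in>{1..m}. x \<noteq> a j *\<^sub>R \<eta>" by (auto simp: a_def)
        show "poisson_comb m \<epsilon> \<eta> x =
            (\<Sum>j = 1..m. - (w j * a j ^ (d - 1) / (a j * \<omega>))) +
            (\<Sum>j = 1..m. (w j * a j ^ (d - 1) * 2 / \<omega>) * dir_deriv \<eta>
               (\<lambda>z. ln (1 / norm (z - (1 + real j * \<epsilon>) *\<^sub>R \<eta>))) x)"
          unfolding expand[OF x] a_eq sum.distrib[symmetric]
        proof (rule sum.cong[OF refl])
          fix j assume j: "j \<in> {1..m}"
          show "w j * a j ^ (d - 1) *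
            (- (1 / (a j * \<omega>)) * (1 / norm (x - a j *\<^sub>R \<eta>) ^ (d - 2))
             - (2 / \<omega>) * ((x - a j *\<^sub>R \<eta>) \<bullet> \<eta> / norm (x - a j *\<^sub>R \<eta>) ^ d)) =
            (- (w j * a j ^ (d - 1) / (a j * \<omega>))) +
            (w j * a j ^ (d - 1) * 2 / \<omega>) * dir_deriv \<eta> (\<lambda>z. ln (1 / norm (z - a j *\<^sub>R \<eta>))) x"
            unfolding dir_deriv_ln_inverse_norm[OF bspec[OF x j]] using d2 by (simp add: d_def right_diff_distrib)
        qed
      qed
      show "(\<forall>x \<in> sphere 0 1. poisson_comb m \<epsilon> \<eta> x = F (x \<bullet> \<eta>)) \<and>
        (\<forall>x \<in> sphere 0 1.
           \<bar>F (x \<bullet> \<eta>)\<bar> \<le> c / \<omega> * \<epsilon> powi (- int CARD('n) + 1) /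
             (1 + inverse \<epsilon> * sphere_dist x \<eta>) ^ (m + CARD('n) - 1)) \<and>
        (LINT x|sphere_measure. F (x \<bullet> \<eta>)) = 1 \<and>
        (CARD('n) > 2 \<longrightarrow>
          (\<exists>b c' :: nat \<Rightarrow> real. \<forall>x. x \<notin> (\<Union>j\<in>{1..m}. {(1 + real j * \<epsilon>) *\<^sub>R \<eta>}) \<longrightarrow>
            poisson_comb m \<epsilon> \<eta> x =
              (\<Sum>j = 1..m. b j / norm (x - (1 + real j * \<epsilon>) *\<^sub>R \<eta>) ^ (CARD('n) - 2)) +
              (\<Sum>j = 1..m. c' j * dir_deriv \<eta>
                 (\<lambda>z. 1 / norm (z - (1 + real j * \<epsilon>) *\<^sub>R \<eta>) ^ (CARD('n) - 2)) x))) \<and>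
        (CARD('n) = 2 \<longrightarrow>
          (\<exists>(b0 :: real) (c' :: nat \<Rightarrow> real). \<forall>x. x \<notin> (\<Union>j\<in>{1..m}. {(1 + real j * \<epsilon>) *\<^sub>R \<eta>}) \<longrightarrow>
            poisson_comb m \<epsilon> \<eta> x =
              b0 + (\<Sum>j = 1..m. c' j * dir_deriv \<eta>
                 (\<lambda>z. ln (1 / norm (z - (1 + real j * \<epsilon>) *\<^sub>R \<eta>))) x)))"
        using on_sphere decay mass rep rep2 by blast
    qed
  qed
qed

end
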